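(* The set $\mathcal H^{gen}/\mathrm{PSp}(4,\mathbb R)$ of generic ordered right-angled hexagons up to isometry is parametrized by $\mathfrak a^3\times\mathrm{PSO}(2)^2/_\sim$, where for $(S_1,S_2)\in\mathrm{PSO}(2)^2$ and $r=\begin{pmatrix}-1&0\\0&1\end{pmatrix}$ the equivalence relation is $(S_1,S_2)\sim(rS_1r,rS_2r)$. The parametrization (a bijection) is given by $$(\underline b,\underline c,\underline d,[S_1,S_2])\mapsto[(0,A,\mathrm{Id},C,D,\infty)]$$ where $\underline b=(b_1,b_2)$, $\underline c=(c_1,c_2)$, $\underline d=(d_1,d_2)$ and $$A=S_1^T\begin{pmatrix}\frac1{e^{b_2}}&0\\0&\frac1{e^{b_1}}\end{pmatrix}S_1,\qquad C=\begin{pmatrix}e^{c_1}&0\\0&e^{c_2}\end{pmatrix},$$ $$D=\begin{pmatrix}0&\sqrt{e^{c_1}}\\-\sqrt{e^{c_2}}&0\end{pmatrix}S_2\begin{pmatrix}e^{d_1}&0\\0&e^{d_2}\end{pmatrix}S_2^T\begin{pmatrix}0&-\sqrt{e^{c_2}}\\\sqrt{e^{c_1}}&0\end{pmatrix}.$$ The parameter space can be rewritten as $\mathfrak a^3\times[0,2\pi)^2/_\sim$, where $(\alpha_1,\alpha_2)\in[0,2\pi)^2$ corresponds to $(S_1,S_2)$ with $S_i=\begin{pmatrix}\cos\frac{\alpha_i}2&-\sin\frac{\alpha_i}2\\\sin\frac{\alpha_i}2&\cos\frac{\alpha_i}2\end{pmatrix}$ and the equivalence relation is $(\alpha_1,\alpha_2)\sim(2\pi-\alpha_1,2\pi-\alpha_2)$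 (modulo $2\pi$).
   Context: $\mathrm{PSp}(4,\mathbb R)=\mathrm{Sp}(4,\mathbb R)/\{\pm\mathrm{Id}\}$ where $\mathrm{Sp}(4,\mathbb R)$ preserves the form with matrix $\begin{pmatrix}0&\mathrm{Id}\\-\mathrm{Id}&0\end{pmatrix}$; $\mathrm{PSO}(2)=\mathrm{SO}(2)/\{\pm\mathrm{Id}\}$. $\mathcal X=\{X+iY: X\in\mathrm{Sym}(2,\mathbb R),Y\in\mathrm{Sym}^+(2,\mathbb R)\}$ is the Siegel space. A real symmetric matrix $X$ denotes the Lagrangian of $\mathbb R^4$ spanned by the columns of $\binom{X}{\mathrm{Id}}$, and $\infty=\langle e_1,e_2\rangle$. A triple of pairwise transverse Lagrangians is maximal if it is in the $\mathrm{Sp}(4,\mathbb R)$-orbit of $(\infty,0,\mathrm{Id})$ (so $(\infty,X,Y)$ is maximal iff $Y-X$ is positive definite); an $m$-tuple $(l_1,\dots,l_m)$ is maximal if $(l_i,l_j,l_k)$ is maximal for all $i<j<k$. Cross-ratio: $R(l_1,l_2,l_3,l_4)=p_{l_1}^{\|l_2}\circ p_{l_4}^{\|l_3}|_{l_1}$, where $p_l^{\|l'}$ is the projection to $l$ parallel to $l'$ (e.g. $R(0,Z,X,\infty)=Z^{-1}X$). A maximal quadruple $(P,X,Y,Q)$ is generic if the eigenvalues of $R(P,X,Y,Q)$ are distinct. An ordered right-angled hexagon of $\mathcal X$ (a cyclic sequence of six consecutively orthogonal $\mathbb R$-tubes with a chosen first tube) is uniquely determined by, and identified with, a maximal 6-tuple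 $(P,A,B,C,D,Q)$ of Lagrangians (the chosen tube having endpoints $P,Q$); $\mathrm{PSp}(4,\mathbb R)$ acts diagonally. The set of generic hexagons is $\mathcal H^{gen}=\{(P,A,B,C,D,Q)\text{ maximal}: (P,A,B,Q),(P,B,C,Q),(P,C,D,Q)\text{ generic}\}$. $\mathfrak a=\{(x_1,x_2)\in\mathbb R^2:x_1>x_2>0\}$. *)

theory Defs
  imports "HOL-Analysis.Analysis" "HOL-Algebra.Group_Action" "HOL-Library.Real_Mod"
begin

type_synonym mat2 = "real^2^2"
type_synonym mat4 = "real^4^4"
type_synonym subsp4 = "(real^4) set"

definition mk2 :: "real \<Rightarrow> real \<Rightarrow> real \<Rightarrow> real \<Rightarrow> mat2" where
  "mk2 a b c d = vector [vector [a, b], vector [c, d]]"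

section \<open>The groups\<close>

definition J4 :: mat4 where
  "J4 = vector [vector [ 0,  0, 1, 0],
                vector [ 0,  0, 0, 1],
                vector [-1,  0, 0, 0],
                vector [ 0, -1, 0, 0]]"

definition Sp4 :: "mat4 monoid" where
  "Sp4 = \<lparr>carrier = {g. transpose g ** J4 ** g = J4}, mult = (**), one = mat 1\<rparr>"

definition PSp4 :: "mat4 set monoid" where
  "PSp4 = Sp4 Mod {mat 1, - mat 1}"

definition SO2 :: "mat2 monoid" where
  "SO2 = \<lparr>carrier = {S. rotation_matrix S}, mult = (**), one = mat 1\<rparr>"

definition PSO2 :: "mat2 set monoid" where
  "PSO2 = SO2 Mod {mat 1, - mat 1}"

definition PSO2_class :: "mat2 \<Rightarrow> mat2 set" where
  "PSO2_class S = {mat 1, - mat 1} #>\<^bsub>SO2\<^esub> S"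

section \<open>Lagrangians and maximal tuples\<close>

definition symp :: "real^4 \<Rightarrow> real^4 \<Rightarrow> real" where
  "symp x y = x \<bullet> (J4 *v y)"

definition lagrangian :: "subsp4 \<Rightarrow> bool" where
  "lagrangian l \<longleftrightarrow> subspace l \<and> dim l = 2 \<and> (\<forall>x\<in>l. \<forall>y\<in>l. symp x y = 0)"

text \<open>For Lagrangians of \<open>real^4\<close>, trivial intersection is the same as being complementary,
  the dimensions adding up to 4.\<close>

definition transverse :: "subsp4 \<Rightarrow> subsp4 \<Rightarrow> bool" where
  "transverse l l' \<longleftrightarrow> l \<inter> l' = {0}"

text \<open>The Lagrangian denoted by a symmetric matrix \<open>X\<close>: the span of the columns of the
  4-by-2 matrix with upper block \<open>X\<close> and lower block the identity.\<close>

definition Lag :: "mat2 \<Rightarrow> subsp4" where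
  "Lag X = span (columns (vector [X$1, X$2, mat 1 $ 1, mat 1 $ 2] :: real^2^4))"

definition Lag_inf :: subsp4 where
  "Lag_inf = span {axis 1 1, axis 2 1}"

definition maximal_triple :: "subsp4 \<Rightarrow> subsp4 \<Rightarrow> subsp4 \<Rightarrow> bool" where
  "maximal_triple l1 l2 l3 \<longleftrightarrow>
     lagrangian l1 \<and> lagrangian l2 \<and> lagrangian l3 \<and>
     transverse l1 l2 \<and> transverse l1 l3 \<and> transverse l2 l3 \<and>
     (\<exists>g\<in>carrier Sp4. l1 = (*v) g ` Lag_inf \<and> l2 = (*v) g ` Lag 0 \<and> l3 = (*v) g ` Lag (mat 1))"

definition maximal_tuple :: "subsp4 list \<Rightarrow> bool" where
  "maximal_tuple ls \<longleftrightarrow>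
     (\<forall>i j k. i < j \<longrightarrow> j < k \<longrightarrow> k < length ls \<longrightarrow> maximal_triple (ls ! i) (ls ! j) (ls ! k))"

section \<open>Cross-ratio and genericity\<close>

text \<open>\<open>proj_par l l'\<close> is the projection to \<open>l\<close> parallel to \<open>l'\<close>; it is meaningful only when
  \<open>l\<close> and \<open>l'\<close> are complementary.\<close>

definition proj_par :: "subsp4 \<Rightarrow> subsp4 \<Rightarrow> real^4 \<Rightarrow> real^4" where
  "proj_par l l' x = (THE y. y \<in> l \<and> x - y \<in> l')"

definition cross_ratio :: "subsp4 \<Rightarrow> subsp4 \<Rightarrow> subsp4 \<Rightarrow> subsp4 \<Rightarrow> real^4 \<Rightarrow> real^4" where
  "cross_ratio l1 l2 l3 l4 = restrict (proj_par l1 l2 \<circ> proj_par l4 l3) l1"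

text \<open>Complex eigenvalues of a real endomorphism \<open>T\<close> of \<open>l\<close>: the equation
  \<open>T (u + i v) = z (u + i v)\<close> in the complexification of \<open>l\<close>, split into its real and
  imaginary parts.\<close>

definition eigenvals :: "subsp4 \<Rightarrow> (real^4 \<Rightarrow> real^4) \<Rightarrow> complex set" where
  "eigenvals l T = {z. \<exists>u\<in>l. \<exists>v\<in>l. (u \<noteq> 0 \<or> v \<noteq> 0) \<and>
     T u = Re z *\<^sub>R u - Im z *\<^sub>R v \<and> T v = Im z *\<^sub>R u + Re z *\<^sub>R v}"

text \<open>\<open>P\<close> is a plane, so the two eigenvalues of the cross-ratio, counted with multiplicity,
  are distinct iff its set of eigenvalues has two elements.\<close>

definition generic_quadruple :: "subsp4 \<Rightarrow> subsp4 \<Rightarrow> subsp4 \<Rightarrow> subsp4 \<Rightarrow> bool" where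
  "generic_quadruple P X Y Q \<longleftrightarrow>
     maximal_tuple [P, X, Y, Q] \<and> card (eigenvals P (cross_ratio P X Y Q)) = 2"

section \<open>Generic hexagons\<close>

text \<open>An ordered right-angled hexagon is identified with a maximal 6-tuple
  \<open>[P, A, B, C, D, Q]\<close>, the chosen tube having endpoints \<open>P\<close> and \<open>Q\<close>.\<close>

definition Hgen :: "subsp4 list set" where
  "Hgen = {[P, A, B, C, D, Q] | P A B C D Q.
     maximal_tuple [P, A, B, C, D, Q] \<and>
     generic_quadruple P A B Q \<and> generic_quadruple P B C Q \<and> generic_quadruple P C D Q}"

text \<open>An element of \<open>PSp4\<close> is a coset \<open>{g, - g}\<close>; both representatives send a subspace to the
  same subspace, so the union below is the image under either of them.\<close>

definition PSp4_act :: "mat4 set \<Rightarrow> subsp4 list \<Rightarrow> subsp4 list" where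
  "PSp4_act K = map (\<lambda>l. \<Union>g\<in>K. (*v) g ` l)"

section \<open>The parameter space\<close>

definition chamber :: "(real \<times> real) set" where
  "chamber = {(x1, x2). x1 > x2 \<and> x2 > 0}"

definition refl_mat :: mat2 where
  "refl_mat = mk2 (-1) 0 0 1"

definition conj_r :: "mat2 set \<Rightarrow> mat2 set" where
  "conj_r K = (\<lambda>S. refl_mat ** S ** refl_mat) ` K"

definition PSO2_rel :: "((mat2 set \<times> mat2 set) \<times> (mat2 set \<times> mat2 set)) set" where
  "PSO2_rel = {((K1, K2), (L1, L2)). K1 \<in> carrier PSO2 \<and> K2 \<in> carrier PSO2 \<and>
     ((L1, L2) = (K1, K2) \<or> (L1, L2) = (conj_r K1, conj_r K2))}"

definition angles :: "(real \<times> real) set" where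
  "angles = {0..<2*pi} \<times> {0..<2*pi}"

definition angle_rel :: "((real \<times> real) \<times> (real \<times> real)) set" where
  "angle_rel = {((\<alpha>1, \<alpha>2), (\<beta>1, \<beta>2)). (\<alpha>1, \<alpha>2) \<in> angles \<and> (\<beta>1, \<beta>2) \<in> angles \<and>
     ((\<beta>1, \<beta>2) = (\<alpha>1, \<alpha>2) \<or>
      [\<beta>1 = 2*pi - \<alpha>1] (rmod 2*pi) \<and> [\<beta>2 = 2*pi - \<alpha>2] (rmod 2*pi))}"

definition half_rot :: "real \<Rightarrow> mat2" where
  "half_rot \<alpha> = mk2 (cos (\<alpha>/2)) (- sin (\<alpha>/2)) (sin (\<alpha>/2)) (cos (\<alpha>/2))"

definition parA :: "real \<times> real \<Rightarrow> mat2 \<Rightarrow> mat2" where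
  "parA b S1 = transpose S1 ** mk2 (1 / exp (snd b)) 0 0 (1 / exp (fst b)) ** S1"

definition parC :: "real \<times> real \<Rightarrow> mat2" where
  "parC c = mk2 (exp (fst c)) 0 0 (exp (snd c))"

definition parD :: "real \<times> real \<Rightarrow> real \<times> real \<Rightarrow> mat2 \<Rightarrow> mat2" where
  "parD c d S2 =
     mk2 0 (sqrt (exp (fst c))) (- sqrt (exp (snd c))) 0 ** S2
       ** mk2 (exp (fst d)) 0 0 (exp (snd d))
       ** transpose S2 ** mk2 0 (- sqrt (exp (snd c))) (sqrt (exp (fst c))) 0"

end

theory Submission
  imports Defs
begin

text \<open>After moving \<open>(P, B, Q)\<close> to \<open>(0, Id, \<infinity>)\<close>, the stabilizer of this triple in \<open>Sp(4, \<real>)\<close> is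
  \<open>O(2)\<close> acting by congruence, and maximality of \<open>(0, A, Id, C, D, \<infinity>)\<close> says that
  \<open>0 < A < Id < C < D\<close> in the Loewner order. Diagonalizing \<open>C\<close> reduces the remaining freedom to the
  diagonal matrices with entries \<open>\<plusminus>1\<close>, that is, modulo \<open>\<plusminus>Id\<close>, to conjugation by \<open>r\<close>. The spectral
  theorem then parametrizes \<open>A\<close>, and \<open>D\<close> in the coordinates that turn \<open>C\<close> into \<open>Id\<close>, by their eigenvalues,
  which genericity makes distinct, and by a rotation that is unique up to sign.\<close>

text \<open>The parameters are logarithms of cross-ratio eigenvalues: R(0,A,Id,inf) = A^-1,
  R(0,Id,C,inf) = C and R(0,C,D,inf) = C^-1 D have eigenvalues exp(b_i), exp(c_i), exp(d_i), and the
  Loewner inequalities say that these exceed 1. The inverse in the first case reverses the order,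
  hence exp(-b_2) precedes exp(-b_1) in A. Any m with m m^T = C turns C into Id; the one in the
  formula for D is the root of C times a quarter turn. Conjugation by r only changes its sign, which
  congruence ignores, so r acts on S_2 exactly as on S_1. The obstacle is that maximality is defined
  by an orbit: a triple with an entry at infinity translates directly into positivity, but a 6-tuple
  also contains triples of three finite Lagrangians. These are brought to infinity by simultaneous
  diagonalization and the inversion X -> -X^-1. The half angles come from the quotient by the sign:
  for alpha in [0, 2 pi) they run through half a turn, which meets every rotation once up to sign,
  and (2 pi - alpha)/2 = pi - alpha/2 gives minus the inverse rotation.\<close>

section \<open>Calculus of explicit 2-by-2 matrices\<close>

lemma mk2_nth [simp]:
  "mk2 a b c d $ 1 $ 1 = a" "mk2 a b c d $ 1 $ 2 = b"
  "mk2 a b c d $ 2 $ 1 = c" "mk2 a b c d $ 2 $ 2 = d"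
  by (simp_all add: mk2_def)

lemma mk2_eta: "mk2 (M$1$1) (M$1$2) (M$2$1) (M$2$2) = M"
  by (simp add: vec_eq_iff forall_2)

lemma mat2_cases:
  obtains a b c d where "M = mk2 a b c d"
  by (metis mk2_eta)

text \<open>Since \<open>0\<close> and \<open>mat 1\<close> are rewritten as well, an identity
  between explicit matrices becomes polynomial identities between entries.\<close>

lemma mk2_simps:
  "mk2 a b c d ** mk2 a' b' c' d' = mk2 (a*a' + b*c') (a*b' + b*d') (c*a' + d*c') (c*b' + d*d')"
  "transpose (mk2 a b c d) = mk2 a c b d"
  "mk2 a b c d + mk2 a' b' c' d' = mk2 (a+a') (b+b') (c+c') (d+d')"
  "mk2 a b c d - mk2 a' b' c' d' = mk2 (a-a') (b-b') (c-c') (d-d')"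
  "- mk2 a b c d = mk2 (-a) (-b) (-c) (-d)"
  "mat 1 = mk2 1 0 0 1"
  "0 = mk2 0 0 0 0"
  "mk2 a b c d = mk2 a' b' c' d' \<longleftrightarrow> a = a' \<and> b = b' \<and> c = c' \<and> d = d'"
  "det (mk2 a b c d) = a * d - b * c"
  "mk2 a b c d *v v = vector [a * v$1 + b * v$2, c * v$1 + d * v$2]"
  by (auto simp: vec_eq_iff forall_2 matrix_matrix_mult_def transpose_def sum_2 mat_def det_2
        matrix_vector_mult_def)

text \<open>On these types \<open>*\<close> is componentwise, so the simplification rules for rings
  do not speak about \<open>**\<close>.\<close>

lemma matrix_ring_simps:
  fixes A B C :: mat2
  shows "(A + B) ** C = A ** C + B ** C" "A ** (B + C) = A ** B + A ** C"
    "(- A) ** B = - (A ** B)" "A ** (- B) = - (A ** B)"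
    "0 ** A = 0" "A ** 0 = 0"
    "transpose (A + B) = transpose A + transpose B" "transpose (- A) = - transpose A"
    "transpose (0::mat2) = 0" "transpose (A - B) = transpose A - transpose B"
    "(A - B) ** C = A ** C - B ** C" "A ** (B - C) = A ** B - A ** C"
  by (auto simp: vec_eq_iff forall_2 matrix_matrix_mult_def transpose_def sum_2 algebra_simps)

lemma matrix_vector_simps:
  fixes A B :: mat2
  shows "(- A) *v v = - (A *v v)" "A *v (- v) = - (A *v v)"
  by (auto simp: vec_eq_iff forall_2 matrix_vector_mult_def sum_2)

section \<open>Block matrices\<close>

lemma vector_4 [simp]:
  "(vector [a, b, c, d] :: 'a::zero^4) $ 1 = a" "(vector [a, b, c, d] :: 'a^4) $ 2 = b"
  "(vector [a, b, c, d] :: 'a^4) $ 3 = c" "(vector [a, b, c, d] :: 'a^4) $ 4 = d"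
  by (simp_all add: vector_def)

text \<open>In this splitting of \<open>real^4\<close> into two planes, \<open>Lag X\<close> is the
  graph of \<open>X\<close> over the second plane and \<open>Lag_inf\<close> is the first
  plane.\<close>

definition join :: "real^2 \<Rightarrow> real^2 \<Rightarrow> real^4" where
  "join u v = vector [u$1, u$2, v$1, v$2]"

definition blk :: "mat2 \<Rightarrow> mat2 \<Rightarrow> mat2 \<Rightarrow> mat2 \<Rightarrow> mat4" where
  "blk a b c d = vector [join (a$1) (b$1), join (a$2) (b$2), join (c$1) (d$1), join (c$2) (d$2)]"

lemma join_nth [simp]: "join u v $ 1 = u$1" "join u v $ 2 = u$2" "join u v $ 3 = v$1" "join u v $ 4 = v$2"
  by (simp_all add: join_def)

lemma blk_nth [simp]:
  "blk a b c d $ 1 = join (a$1) (b$1)" "blk a b c d $ 2 = join (a$2) (b$2)"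
  "blk a b c d $ 3 = join (c$1) (d$1)" "blk a b c d $ 4 = join (c$2) (d$2)"
  by (simp_all add: blk_def)

lemma join_eq_iff [simp]: "join u v = join u' v' \<longleftrightarrow> u = u' \<and> v = v'"
  by (auto simp: vec_eq_iff forall_2 forall_4)

lemma blk_eq_iff: "blk a b c d = blk a' b' c' d' \<longleftrightarrow> a = a' \<and> b = b' \<and> c = c' \<and> d = d'"
  by (auto simp: vec_eq_iff forall_2 forall_4)

lemma blk_cases:
  obtains a b c d where "g = blk a b c d"
proof
  show "g = blk (mk2 (g$1$1) (g$1$2) (g$2$1) (g$2$2)) (mk2 (g$1$3) (g$1$4) (g$2$3) (g$2$4))
    (mk2 (g$3$1) (g$3$2) (g$4$1) (g$4$2)) (mk2 (g$3$3) (g$3$4) (g$4$3) (g$4$4))"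
    by (simp add: vec_eq_iff forall_4)
qed

lemma join_simps:
  "join u v + join u' v' = join (u + u') (v + v')"
  "join u v - join u' v' = join (u - u') (v - v')"
  "r *\<^sub>R join u v = join (r *\<^sub>R u) (r *\<^sub>R v)"
  "join u v = 0 \<longleftrightarrow> u = 0 \<and> v = 0"
  "join u v \<bullet> join u' v' = u \<bullet> u' + v \<bullet> v'"
  by (auto simp: vec_eq_iff forall_4 forall_2 inner_vec_def sum_4 sum_2)

lemma zero_eq_join: "0 = join 0 0"
  by (simp add: vec_eq_iff forall_4)

lemma blk_mult_join: "blk a b c d *v join u v = join (a *v u + b *v v) (c *v u + d *v v)"
  by (simp add: vec_eq_iff forall_4 forall_2 matrix_vector_mult_def sum_4 sum_2)

lemma blk_mult:
  "blk a b c d ** blk a' b' c' d' =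
     blk (a ** a' + b ** c') (a ** b' + b ** d') (c ** a' + d ** c') (c ** b' + d ** d')"
  by (simp add: vec_eq_iff forall_4 forall_2 matrix_matrix_mult_def sum_4 sum_2)

lemma transpose_blk: "transpose (blk a b c d) = blk (transpose a) (transpose c) (transpose b) (transpose d)"
  by (simp add: vec_eq_iff forall_4 transpose_def)

lemma one_eq_blk: "mat 1 = blk (mat 1) 0 0 (mat 1)"
  by (simp add: vec_eq_iff forall_4 mat_def)

lemma uminus_blk: "- blk a b c d = blk (- a) (- b) (- c) (- d)"
  by (simp add: vec_eq_iff forall_4)

lemma J4_eq_blk: "J4 = blk 0 (mat 1) (- mat 1) 0"
  by (simp add: J4_def vec_eq_iff forall_4 mat_def)

lemma blk_in_Sp4_iff:
  "blk a b c d \<in> carrier Sp4 \<longleftrightarrow>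
     transpose a ** c = transpose c ** a \<and> transpose b ** d = transpose d ** b \<and>
     transpose a ** d - transpose c ** b = mat 1"
proof -
  \<comment> \<open>The lower left block of the defining equation is, up to sign, the transpose of
    the upper right one, so three block equations suffice.\<close>
  have *: "transpose d ** a - transpose b ** c = transpose (transpose a ** d - transpose c ** b)"
    by (simp add: matrix_ring_simps matrix_transpose_mul)
  have "blk a b c d \<in> carrier Sp4 \<longleftrightarrow>
     transpose a ** c - transpose c ** a = 0 \<and> transpose b ** d - transpose d ** b = 0 \<and>
     transpose a ** d - transpose c ** b = mat 1 \<and> transpose d ** a - transpose b ** c = mat 1"
    unfolding Sp4_def J4_eq_blk
    by (auto simp: transpose_blk blk_mult blk_eq_iff matrix_ring_simps algebra_simps)
  also have "\<dots> \<longleftrightarrow> transpose a ** c - transpose c ** a = 0 \<and> transpose b ** d - transpose d ** b = 0 \<and>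
     transpose a ** d - transpose c ** b = mat 1"
    unfolding * by auto
  finally show ?thesis by simp
qed

lemma symp_join: "symp (join u v) (join u' v') = u \<bullet> v' - v \<bullet> u'"
  by (simp add: symp_def J4_eq_blk blk_mult_join join_simps matrix_vector_simps)

section \<open>The action of the symplectic group\<close>

lemma J4_square: "J4 ** J4 = - mat 1"
  by (simp add: J4_eq_blk blk_mult one_eq_blk uminus_blk matrix_ring_simps)

lemma one_in_Sp4: "mat 1 \<in> carrier Sp4"
  by (simp add: Sp4_def)

lemma mult_in_Sp4:
  assumes "g \<in> carrier Sp4" "h \<in> carrier Sp4"
  shows "g ** h \<in> carrier Sp4"
proof -
  have "transpose (g ** h) ** J4 ** (g ** h) = transpose h ** (transpose g ** J4 ** g) ** h"
    by (simp add: matrix_transpose_mul matrix_mul_assoc)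
  then show ?thesis using assms by (simp add: Sp4_def)
qed

lemma mat4_minus_mult: "(- A) ** B = - (A ** B)" "A ** (- B) = - (A ** B)" for A B :: mat4
  by (auto simp: vec_eq_iff matrix_matrix_mult_def sum_negf)

lemma Sp4_inverse:
  assumes g: "g \<in> carrier Sp4"
  obtains h where "h \<in> carrier Sp4" "h ** g = mat 1" "g ** h = mat 1"
proof -
  have gJ: "transpose g ** J4 ** g = J4" using g by (simp add: Sp4_def)
  \<comment> \<open>As J squares to -1, the relation g^T J g = J says that -J g^T J is a left
    inverse of g.\<close>
  define h where "h = - (J4 ** transpose g ** J4)"
  have "h ** g = - (J4 ** (transpose g ** J4 ** g))"
    by (simp add: h_def matrix_mul_assoc mat4_minus_mult)
  then have 1: "h ** g = mat 1" by (simp add: gJ J4_square)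
  then have 2: "g ** h = mat 1" using matrix_left_right_inverse by blast
  have "transpose h ** J4 ** h = transpose h ** (transpose g ** J4 ** g) ** h"
    by (simp add: gJ)
  also have "\<dots> = transpose (g ** h) ** J4 ** (g ** h)"
    by (simp add: matrix_transpose_mul matrix_mul_assoc)
  finally have "h \<in> carrier Sp4" by (simp add: 2 Sp4_def)
  then show thesis using 1 2 that by blast
qed

lemma image_mult: "(*v) g ` ((*v) h ` l) = (*v) (g ** h) ` l"
  by (simp add: image_image matrix_vector_mul_assoc)

lemma image_one [simp]: "(*v) (mat 1) ` l = l"
  by simp

lemma image_Sp4_inverse:
  assumes "h ** g = mat 1"
  shows "(*v) h ` ((*v) g ` l) = l"
  by (simp add: image_mult assms)

lemma Lag_eq: "Lag X = {join (X *v v) v | v. True}"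
proof -
  have "columns (vector [X$1, X$2, mat 1 $ 1, mat 1 $ 2] :: real^2^4) =
      {join (column 1 X) (axis 1 1), join (column 2 X) (axis 2 1)}"
    unfolding columns_def UNIV_2
    by (auto simp: vec_eq_iff forall_4 column_def mat_def axis_def intro: exI[of _ 1] exI[of _ 2])
  then have "x \<in> Lag X \<longleftrightarrow> (\<exists>r s. x = r *\<^sub>R join (column 1 X) (axis 1 1) + s *\<^sub>R join (column 2 X) (axis 2 1))"
    for x unfolding Lag_def by (auto simp: span_insert algebra_simps)
  moreover have "r *\<^sub>R join (column 1 X) (axis 1 1) + s *\<^sub>R join (column 2 X) (axis 2 1)
      = join (X *v vector [r, s]) (vector [r, s])" for r s
    by (simp add: vec_eq_iff forall_4 axis_def column_def matrix_vector_mult_def sum_2)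
  moreover have "v = vector [v$1, v$2]" for v :: "real^2"
    by (simp add: vec_eq_iff forall_2)
  ultimately show ?thesis by (auto; metis)
qed

lemma Lag_inf_eq: "Lag_inf = {join v 0 | v. True}"
proof -
  have "x \<in> Lag_inf \<longleftrightarrow> (\<exists>r s. x = r *\<^sub>R axis 1 1 + s *\<^sub>R axis 2 1)" for x
    unfolding Lag_inf_def by (auto simp: span_insert algebra_simps)
  moreover have "r *\<^sub>R axis 1 1 + s *\<^sub>R axis 2 1 = join (vector [r, s]) 0" for r s
    by (simp add: vec_eq_iff forall_4 axis_def)
  moreover have "v = vector [v$1, v$2]" for v :: "real^2"
    by (simp add: vec_eq_iff forall_2)
  ultimately show ?thesis by (auto; metis)
qed


lemma in_Lag_iff: "join u v \<in> Lag X \<longleftrightarrow> u = X *v v"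
  by (auto simp: Lag_eq)

lemma in_Lag_inf_iff: "join u v \<in> Lag_inf \<longleftrightarrow> v = 0"
  by (auto simp: Lag_inf_eq)

declare transpose_matrix_vector [simp del]

section \<open>Symmetric and positive definite matrices\<close>

text \<open>Over the reals a positive quadratic form does not force its matrix to be symmetric, so
  symmetry is part of the notion.\<close>

definition pd :: "mat2 \<Rightarrow> bool" where
  "pd X \<longleftrightarrow> transpose X = X \<and> (\<forall>v. v \<noteq> 0 \<longrightarrow> v \<bullet> (X *v v) > 0)"

abbreviation diag :: "real \<Rightarrow> real \<Rightarrow> mat2" where
  "diag p q \<equiv> mk2 p 0 0 q"

abbreviation rot :: "real \<Rightarrow> real \<Rightarrow> mat2" where
  "rot c s \<equiv> mk2 c (- s) s c"

text \<open>\<open>matrix_mul_assoc\<close> associates products to the left, so the cancellation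
  rules are phrased for the last two factors of \<open>x ** a ** a'\<close>.\<close>

lemma mat2_cancel:
  fixes a a' x :: mat2
  assumes "a ** a' = mat 1"
  shows "a' ** a = mat 1" "x ** a ** a' = x" "x ** a' ** a = x"
    "transpose a ** transpose a' = mat 1" "transpose a' ** transpose a = mat 1"
    "x ** transpose a ** transpose a' = x" "x ** transpose a' ** transpose a = x"
proof -
  have *: "x ** b ** c = x" if "b ** c = mat 1" for b c :: mat2
    using that matrix_mul_assoc[of x b c] by simp
  show 1: "a' ** a = mat 1" using assms matrix_left_right_inverse by blast
  show 2: "transpose a ** transpose a' = mat 1" by (simp flip: matrix_transpose_mul add: 1)
  show 3: "transpose a' ** transpose a = mat 1" by (simp flip: matrix_transpose_mul add: assms)
  show "x ** a ** a' = x" "x ** a' ** a = x"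
    "x ** transpose a ** transpose a' = x" "x ** transpose a' ** transpose a = x"
    using * assms 1 2 3 by blast+
qed

lemma inner_matrix_vector: "u \<bullet> (A *v v) = (transpose A *v u) \<bullet> v" for A :: "real^'n^'m"
  by (metis dot_lmul_matrix transpose_matrix_vector)

lemma pd_symmetric: "pd X \<Longrightarrow> transpose X = X"
  by (simp add: pd_def)

lemma pd_add: "pd X \<Longrightarrow> pd Y \<Longrightarrow> pd (X + Y)"
  by (simp add: pd_def matrix_ring_simps matrix_vector_mult_add_rdistrib inner_add_right add_pos_pos)

lemma pd_conj:
  assumes "pd X" "a ** a' = mat 1"
  shows "pd (a ** X ** transpose a)"
  unfolding pd_def
proof (intro conjI allI impI)
  show "transpose (a ** X ** transpose a) = a ** X ** transpose a"
    using assms by (simp add: pd_def matrix_transpose_mul matrix_mul_assoc)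
  fix v :: "real^2" assume "v \<noteq> 0"
  have "transpose a' *v (transpose a *v v) = v"
    using mat2_cancel[OF assms(2)] by (simp add: matrix_vector_mul_assoc)
  with \<open>v \<noteq> 0\<close> have "transpose a *v v \<noteq> 0" by auto
  moreover have "v \<bullet> ((a ** X ** transpose a) *v v) = (transpose a *v v) \<bullet> (X *v (transpose a *v v))"
    unfolding inner_matrix_vector[of v a, symmetric] by (simp only: matrix_vector_mul_assoc matrix_mul_assoc)
  ultimately show "v \<bullet> ((a ** X ** transpose a) *v v) > 0"
    using assms(1) by (simp add: pd_def)
qed

text \<open>Together with \<open>pd_diag_iff\<close> this turns Loewner inequalities between
  simultaneously diagonalized matrices into inequalities between diagonal entries.\<close>

lemma pd_conj_iff:
  assumes "a ** a' = mat 1"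
  shows "pd (a ** X ** transpose a) \<longleftrightarrow> pd X"
proof
  assume "pd (a ** X ** transpose a)"
  then have "pd (a' ** (a ** X ** transpose a) ** transpose a')"
    using pd_conj mat2_cancel(1)[OF assms] by blast
  then show "pd X"
    using mat2_cancel[OF assms] by (simp add: matrix_mul_assoc)
qed (use pd_conj assms in blast)

lemma pd_diag_iff: "pd (diag p q) \<longleftrightarrow> p > 0 \<and> q > 0"
proof
  assume *: "pd (diag p q)"
  then have "vector [1, 0] \<bullet> (diag p q *v vector [1, 0]) > 0" "vector [0, 1] \<bullet> (diag p q *v vector [0, 1]) > 0"
    unfolding pd_def by (metis vector_2 zero_index zero_neq_one)+
  then show "p > 0 \<and> q > 0"
    by (simp add: mk2_simps inner_vec_def sum_2)
next
  assume pq: "p > 0 \<and> q > 0"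
  show "pd (diag p q)"
    unfolding pd_def
  proof (intro conjI allI impI)
    fix v :: "real^2" assume "v \<noteq> 0"
    then have "v$1 \<noteq> 0 \<or> v$2 \<noteq> 0" by (auto simp: vec_eq_iff forall_2)
    then have "p * (v$1)\<^sup>2 + q * (v$2)\<^sup>2 > 0"
      using pq by (auto intro: add_pos_nonneg add_nonneg_pos)
    then show "v \<bullet> (diag p q *v v) > 0"
      by (simp add: mk2_simps inner_vec_def sum_2 power2_eq_square algebra_simps)
  qed (simp add: mk2_simps)
qed

section \<open>The spectral theorem in dimension two and square roots\<close>

lemma rot_inverse:
  assumes "c\<^sup>2 + s\<^sup>2 = 1"
  shows "rot c s ** transpose (rot c s) = mat 1" "transpose (rot c s) ** rot c s = mat 1"
  using assms by (auto simp: mk2_simps power2_eq_square algebra_simps)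

text \<open>The traceless part of a symmetric matrix is a complex number z = (a - d)/2 + i b, and
  conjugating by the rotation of angle \<theta> multiplies it by exp(2 i \<theta>). Hence rotating
  by half the argument of z diagonalizes, and the eigenvalues are half the trace plus and minus the
  modulus of z.\<close>

lemma spectral:
  assumes "transpose X = X"
  obtains c s p q where "c\<^sup>2 + s\<^sup>2 = 1" "p \<ge> q" "X = rot c s ** diag p q ** transpose (rot c s)"
proof -
  obtain a b b' d where X: "X = mk2 a b b' d" by (rule mat2_cases)
  with assms have b': "b' = b" by (metis mk2_nth(2) mk2_simps(2))
  define z where "z = Complex ((a - d) / 2) b"
  define t where "t = Arg z"
  have "Re z = cmod z * cos t" "Im z = cmod z * sin t"
    by (metis Re_rcis rcis_cmod_Arg t_def, metis Im_rcis rcis_cmod_Arg t_def)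
  then have z: "(a - d) / 2 = cmod z * cos t" "b = cmod z * sin t"
    by (simp_all add: z_def)
  have t: "cos t = (cos (t/2))\<^sup>2 - (sin (t/2))\<^sup>2" "sin t = 2 * sin (t/2) * cos (t/2)"
    using cos_double[of "t/2"] sin_double[of "t/2"] by simp_all
  define c s m r where "c = cos (t/2)" "s = sin (t/2)" "m = (a + d) / 2" "r = cmod z"
  note defs = this
  have 1: "c\<^sup>2 + s\<^sup>2 = 1" by (simp add: defs)
  have "a = m + r * (c\<^sup>2 - s\<^sup>2)" "d = m - r * (c\<^sup>2 - s\<^sup>2)" and b: "b = r * (2 * s * c)"
    using z unfolding t defs by (simp_all add: field_simps)
  then have "a = m * (c\<^sup>2 + s\<^sup>2) + r * (c\<^sup>2 - s\<^sup>2)" "d = m * (c\<^sup>2 + s\<^sup>2) - r * (c\<^sup>2 - s\<^sup>2)"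
    unfolding 1 by simp_all
  then have "X = rot c s ** diag (m + r) (m - r) ** transpose (rot c s)"
    unfolding X b' b by (simp add: mk2_simps power2_eq_square algebra_simps)
  then show thesis using that[OF 1, of "m - r" "m + r"] by (simp add: defs)
qed

lemma spectral_unique:
  assumes cs: "c\<^sup>2 + s\<^sup>2 = 1" and cs': "c'\<^sup>2 + s'\<^sup>2 = 1" and pq: "p > q" and pq': "p' > q'"
    and eq: "rot c s ** diag p q ** transpose (rot c s) = rot c' s' ** diag p' q' ** transpose (rot c' s')"
  shows "p = p' \<and> q = q' \<and> (rot c' s' = rot c s \<or> rot c' s' = - rot c s)"
proof -
  have 1: "c\<^sup>2 * p + s\<^sup>2 * q = c'\<^sup>2 * p' + s'\<^sup>2 * q'" "s\<^sup>2 * p + c\<^sup>2 * q = s'\<^sup>2 * p' + c'\<^sup>2 * q'"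
    "c * s * (p - q) = c' * s' * (p' - q')"
    using eq by (auto simp: mk2_simps power2_eq_square algebra_simps)
  have "(c\<^sup>2 + s\<^sup>2) * (p + q) = (c'\<^sup>2 + s'\<^sup>2) * (p' + q')"
    using 1(1,2) by (simp add: algebra_simps)
  then have sum: "p + q = p' + q'" using cs cs' by simp
  have diff: "(c\<^sup>2 - s\<^sup>2) * (p - q) = (c'\<^sup>2 - s'\<^sup>2) * (p' - q')"
    using 1(1,2) by (simp add: algebra_simps)
  \<comment> \<open>The gap p - q is twice the modulus of the traceless part, so its square is a
    function of the matrix entries; positivity of both gaps then removes the sign.\<close>
  have "(p - q)\<^sup>2 * (c\<^sup>2 + s\<^sup>2)\<^sup>2 = ((c\<^sup>2 - s\<^sup>2) * (p - q))\<^sup>2 + 4 * (c * s * (p - q))\<^sup>2"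
    by (simp add: power2_eq_square algebra_simps)
  also have "\<dots> = ((c'\<^sup>2 - s'\<^sup>2) * (p' - q'))\<^sup>2 + 4 * (c' * s' * (p' - q'))\<^sup>2"
    using diff 1(3) by simp
  also have "\<dots> = (p' - q')\<^sup>2 * (c'\<^sup>2 + s'\<^sup>2)\<^sup>2"
    by (simp add: power2_eq_square algebra_simps)
  finally have "p - q = p' - q'"
    using cs cs' pq pq' by (simp add: power2_eq_iff)
  with sum have e: "p = p'" "q = q'" by auto
  have "c * s = c' * s'" "c\<^sup>2 - s\<^sup>2 = c'\<^sup>2 - s'\<^sup>2" using diff 1(3) e pq by auto
  \<comment> \<open>The squares fix c and s up to separate signs; the product c s ties the two signs
    together.\<close>
  then have "c\<^sup>2 = c'\<^sup>2" "s\<^sup>2 = s'\<^sup>2" "c * s = c' * s'" using cs cs' by auto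
  then have "c' = c \<and> s' = s \<or> c' = - c \<and> s' = - s"
    using cs by (auto simp: power2_eq_iff)
  with e show ?thesis by (auto simp: mk2_simps)
qed

text \<open>The factor \<open>a\<close> is a rotation times the root of the diagonal, not
  necessarily symmetric: what matters is that congruence by it carries Id to \<open>X\<close>. Its
  inverse \<open>a'\<close> provides the lower block of the corresponding symplectic matrix.\<close>

lemma pd_square_root:
  assumes "pd X"
  obtains a a' :: mat2 where "a ** a' = mat 1" "X = a ** transpose a"
proof -
  obtain c s p q where cs: "c\<^sup>2 + s\<^sup>2 = 1" and X: "X = rot c s ** diag p q ** transpose (rot c s)"
    using spectral pd_symmetric assms by metis
  have pq: "p > 0" "q > 0"
    using assms unfolding X pd_conj_iff[OF rot_inverse(1)[OF cs]] pd_diag_iff by auto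
  let ?a = "rot c s ** diag (sqrt p) (sqrt q)" and ?a' = "diag (1 / sqrt p) (1 / sqrt q) ** transpose (rot c s)"
  have "diag (sqrt p) (sqrt q) ** diag (1 / sqrt p) (1 / sqrt q) = mat 1"
    using pq by (simp add: mk2_simps)
  then have "?a ** ?a' = mat 1"
    using rot_inverse(1)[OF cs] by (metis matrix_mul_assoc matrix_mul_lid)
  moreover have D: "diag p q = diag (sqrt p) (sqrt q) ** diag (sqrt p) (sqrt q)"
    using pq by (simp add: mk2_simps)
  have "X = ?a ** transpose ?a"
    unfolding X D matrix_transpose_mul mk2_simps(2) by (simp only: matrix_mul_assoc)
  ultimately show thesis by (rule that)
qed

section \<open>Maximal triples\<close>

lemma subspace_Lag: "subspace (Lag X)" and subspace_Lag_inf: "subspace Lag_inf"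
  by (simp_all add: Lag_def Lag_inf_def)

lemma subspace_image: "subspace l \<Longrightarrow> subspace ((*v) g ` l)"  for g :: mat4
  by (rule linear_subspace_image[OF matrix_vector_mul_linear])

lemma Sp4_inj:
  assumes "g \<in> carrier Sp4"
  shows "inj ((*v) g)"
proof -
  obtain h where "h ** g = mat 1" using Sp4_inverse[OF assms] by blast
  then show ?thesis
    by (intro inj_on_inverseI[of _ "(*v) h"]) (simp add: matrix_vector_mul_assoc)
qed

lemma symp_Sp4:
  assumes "g \<in> carrier Sp4"
  shows "symp (g *v x) (g *v y) = symp x y"
proof -
  have "symp (g *v x) (g *v y) = x \<bullet> ((transpose g ** J4 ** g) *v y)"
    unfolding symp_def
    using inner_matrix_vector[of x "transpose g" "J4 *v (g *v y)"]
    by (simp add: matrix_vector_mul_assoc matrix_mul_assoc)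
  then show ?thesis using assms by (simp add: Sp4_def symp_def)
qed

lemma lagrangian_image:
  assumes "g \<in> carrier Sp4" "lagrangian l"
  shows "lagrangian ((*v) g ` l)"
  using assms Sp4_inj[OF assms(1)]
  by (auto simp: lagrangian_def symp_Sp4 subspace_image dim_image_eq inj_on_subset)

lemma transverse_image:
  assumes "g \<in> carrier Sp4" "transverse l l'"
  shows "transverse ((*v) g ` l) ((*v) g ` l')"
  using assms image_Int[OF Sp4_inj[OF assms(1)]] unfolding transverse_def
  by (metis image_empty image_insert matrix_vector_mult_0_right)

section \<open>Symplectic moves and their effect on Lagrangians\<close>

lemma image_Lag: "(*v) g ` Lag X = range (\<lambda>v. g *v join (X *v v) v)"
  and image_Lag_inf: "(*v) g ` Lag_inf = range (\<lambda>v. g *v join v 0)"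
  by (auto simp: Lag_eq Lag_inf_eq)

lemma Lag_range: "Lag X = range (\<lambda>v. join (X *v v) v)"
  and Lag_inf_range: "Lag_inf = range (\<lambda>v. join v 0)"
  by (auto simp: Lag_eq Lag_inf_eq)

text \<open>Images of Lagrangians are ranges of linear parametrizations; two of them agree as soon
  as they differ by an invertible change of the parameter.\<close>

lemma range_reparametrize:
  assumes "\<And>v. F v = G (h *v v)" "h ** k = mat 1"
  shows "range F = range G"
proof -
  have "G v = F (k *v v)" for v
    by (simp add: assms matrix_vector_mul_assoc)
  then show ?thesis using assms(1) by (auto simp: image_iff)
qed

text \<open>This copy of GL(2) is the stabilizer of the pair \<open>Lag 0\<close>,
  \<open>Lag_inf\<close> (see \<open>Sp4_stabilizer\<close>); its action on symmetric matrices is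
  congruence.\<close>

lemma image_glm:
  assumes "a ** a' = mat 1"
  shows "blk a 0 0 (transpose a') \<in> carrier Sp4"
    "(*v) (blk a 0 0 (transpose a')) ` Lag X = Lag (a ** X ** transpose a)"
    "(*v) (blk a 0 0 (transpose a')) ` Lag_inf = Lag_inf"
proof -
  note c = mat2_cancel[OF assms]
  show "blk a 0 0 (transpose a') \<in> carrier Sp4"
    by (simp add: blk_in_Sp4_iff matrix_ring_simps c)
  show "(*v) (blk a 0 0 (transpose a')) ` Lag X = Lag (a ** X ** transpose a)"
    unfolding image_Lag unfolding Lag_range
    by (rule range_reparametrize[OF _ c(5)]) (simp add: blk_mult_join matrix_vector_mul_assoc c)
  show "(*v) (blk a 0 0 (transpose a')) ` Lag_inf = Lag_inf"
    unfolding image_Lag_inf unfolding Lag_inf_range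
    by (rule range_reparametrize[OF _ assms]) (simp add: blk_mult_join)
qed

lemma image_translation:
  assumes "transpose X = X"
  shows "blk (mat 1) X 0 (mat 1) \<in> carrier Sp4"
    "(*v) (blk (mat 1) X 0 (mat 1)) ` Lag Y = Lag (X + Y)"
    "(*v) (blk (mat 1) X 0 (mat 1)) ` Lag_inf = Lag_inf"
proof -
  show "blk (mat 1) X 0 (mat 1) \<in> carrier Sp4"
    by (simp add: blk_in_Sp4_iff matrix_ring_simps assms)
  show "(*v) (blk (mat 1) X 0 (mat 1)) ` Lag Y = Lag (X + Y)"
    unfolding image_Lag unfolding Lag_range
    by (simp add: blk_mult_join matrix_vector_mult_add_rdistrib add.commute)
  show "(*v) (blk (mat 1) X 0 (mat 1)) ` Lag_inf = Lag_inf"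
    unfolding image_Lag_inf unfolding Lag_inf_range
    by (simp add: blk_mult_join)
qed

lemma minus_one_square: "(- mat 1 :: mat2) ** (- mat 1) = mat 1"
  by (simp add: matrix_ring_simps)

text \<open>This is X -> (Id - X)^-1, of order three modulo sign. It permutes the standard triple
  cyclically, whence maximality is invariant under cyclic rotation of a triple.\<close>

lemma image_cycle:
  shows "blk 0 (mat 1) (- mat 1) (mat 1) \<in> carrier Sp4"
    "(*v) (blk 0 (mat 1) (- mat 1) (mat 1)) ` Lag_inf = Lag 0"
    "(*v) (blk 0 (mat 1) (- mat 1) (mat 1)) ` Lag 0 = Lag (mat 1)"
    "(*v) (blk 0 (mat 1) (- mat 1) (mat 1)) ` Lag (mat 1) = Lag_inf"
proof -
  show "blk 0 (mat 1) (- mat 1) (mat 1) \<in> carrier Sp4"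
    by (simp add: blk_in_Sp4_iff matrix_ring_simps)
  show "(*v) (blk 0 (mat 1) (- mat 1) (mat 1)) ` Lag 0 = Lag (mat 1)"
    unfolding image_Lag unfolding Lag_range by (simp add: blk_mult_join)
  show "(*v) (blk 0 (mat 1) (- mat 1) (mat 1)) ` Lag (mat 1) = Lag_inf"
    unfolding image_Lag unfolding Lag_inf_range by (simp add: blk_mult_join matrix_vector_simps)
  show "(*v) (blk 0 (mat 1) (- mat 1) (mat 1)) ` Lag_inf = Lag 0"
    unfolding image_Lag_inf unfolding Lag_range
    by (rule range_reparametrize[OF _ minus_one_square]) (simp add: blk_mult_join)
qed

text \<open>This is X -> -X^-1; it moves \<open>Lag 0\<close> to infinity, where the positivity
  criterion is available.\<close>

lemma image_inversion:
  assumes "X ** X' = mat 1"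
  shows "blk 0 (mat 1) (- mat 1) 0 \<in> carrier Sp4"
    "(*v) (blk 0 (mat 1) (- mat 1) 0) ` Lag 0 = Lag_inf"
    "(*v) (blk 0 (mat 1) (- mat 1) 0) ` Lag X = Lag (- X')"
proof -
  show "blk 0 (mat 1) (- mat 1) 0 \<in> carrier Sp4"
    by (simp add: blk_in_Sp4_iff matrix_ring_simps)
  show "(*v) (blk 0 (mat 1) (- mat 1) 0) ` Lag 0 = Lag_inf"
    unfolding image_Lag unfolding Lag_inf_range by (simp add: blk_mult_join)
  have "(- X) ** (- X') = mat 1" by (simp add: matrix_ring_simps assms)
  then show "(*v) (blk 0 (mat 1) (- mat 1) 0) ` Lag X = Lag (- X')"
    unfolding image_Lag unfolding Lag_range
    by (rule range_reparametrize[rotated])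
      (simp add: blk_mult_join matrix_vector_simps matrix_vector_mul_assoc matrix_ring_simps
        mat2_cancel(1)[OF assms])
qed

section \<open>Invariance of maximality and its criterion by positivity\<close>

lemma lagrangian_Lag_inf: "lagrangian Lag_inf"
proof -
  have "Lag_inf = (\<lambda>v. join v 0) ` UNIV" by (auto simp: Lag_inf_eq)
  moreover have "linear (\<lambda>v. join v 0)"
    by (rule linearI) (simp_all add: join_simps)
  ultimately have "dim Lag_inf = dim (UNIV :: (real^2) set)"
    using dim_image_eq[of "\<lambda>v. join v 0" UNIV] by (simp add: inj_on_def)
  then have "dim Lag_inf = 2" by simp
  then show ?thesis
    using subspace_Lag_inf by (auto simp: lagrangian_def Lag_inf_eq symp_join)
qed

text \<open>The standard triple consists of pairwise transverse Lagrangians, and symplectic maps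
  preserve both properties.\<close>

lemma maximal_triple_iff:
  "maximal_triple l1 l2 l3 \<longleftrightarrow>
     (\<exists>g\<in>carrier Sp4. l1 = (*v) g ` Lag_inf \<and> l2 = (*v) g ` Lag 0 \<and> l3 = (*v) g ` Lag (mat 1))"
    (is "_ \<longleftrightarrow> ?R")
proof
  assume ?R
  then obtain g where g: "g \<in> carrier Sp4" and
    l: "l1 = (*v) g ` Lag_inf" "l2 = (*v) g ` Lag 0" "l3 = (*v) g ` Lag (mat 1)" by blast
  \<comment> \<open>Both are images of \<open>Lag_inf\<close> under powers of the cyclic element, so
    a dimension is computed only for \<open>Lag_inf\<close>.\<close>
  have "lagrangian (Lag 0)" "lagrangian (Lag (mat 1))"
    using lagrangian_image[OF image_cycle(1)] lagrangian_Lag_inf image_cycle by metis+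
  moreover have "transverse Lag_inf (Lag 0)" "transverse Lag_inf (Lag (mat 1))" "transverse (Lag 0) (Lag (mat 1))"
    by (auto simp: transverse_def Lag_eq Lag_inf_eq zero_eq_join)
  ultimately show "maximal_triple l1 l2 l3"
    using g l lagrangian_Lag_inf unfolding maximal_triple_def
    by (blast intro: lagrangian_image transverse_image)
qed (simp add: maximal_triple_def)

lemma maximal_triple_rotate: "maximal_triple l1 l2 l3 \<Longrightarrow> maximal_triple l2 l3 l1"
  unfolding maximal_triple_iff
proof (elim bexE conjE)
  fix g assume g: "g \<in> carrier Sp4"
    and l: "l1 = (*v) g ` Lag_inf" "l2 = (*v) g ` Lag 0" "l3 = (*v) g ` Lag (mat 1)"
  from g have "g ** blk 0 (mat 1) (- mat 1) (mat 1) \<in> carrier Sp4"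
    by (rule mult_in_Sp4[OF _ image_cycle(1)])
  then show "\<exists>g\<in>carrier Sp4. l2 = (*v) g ` Lag_inf \<and> l3 = (*v) g ` Lag 0 \<and> l1 = (*v) g ` Lag (mat 1)"
    unfolding l by (rule bexI[rotated]) (simp only: image_cycle flip: image_mult)
qed

lemma maximal_triple_image:
  assumes g: "g \<in> carrier Sp4"
  shows "maximal_triple ((*v) g ` l1) ((*v) g ` l2) ((*v) g ` l3) \<longleftrightarrow> maximal_triple l1 l2 l3"
proof -
  have *: "maximal_triple ((*v) g ` l1) ((*v) g ` l2) ((*v) g ` l3)"
    if "maximal_triple l1 l2 l3" "g \<in> carrier Sp4" for g l1 l2 l3
    using that(1) unfolding maximal_triple_iff
  proof (elim bexE conjE)
    fix h assume h: "h \<in> carrier Sp4" and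
      l: "l1 = (*v) h ` Lag_inf" "l2 = (*v) h ` Lag 0" "l3 = (*v) h ` Lag (mat 1)"
    from h have "g ** h \<in> carrier Sp4" using that(2) by (simp add: mult_in_Sp4)
    then show "\<exists>k\<in>carrier Sp4. (*v) g ` l1 = (*v) k ` Lag_inf \<and> (*v) g ` l2 = (*v) k ` Lag 0
        \<and> (*v) g ` l3 = (*v) k ` Lag (mat 1)"
      unfolding l image_mult by blast
  qed
  obtain h where "h \<in> carrier Sp4" "h ** g = mat 1" using Sp4_inverse[OF g] .
  then show ?thesis using *[OF _ g] *[of "(*v) g ` l1" "(*v) g ` l2" "(*v) g ` l3" h]
    by (auto simp: image_Sp4_inverse)
qed

lemma Lag_inject [simp]: "Lag X = Lag Y \<longleftrightarrow> X = Y"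
proof
  assume "Lag X = Lag Y"
  then have "X *v v = Y *v v" for v using in_Lag_iff by metis
  then show "X = Y" by (simp add: matrix_eq)
qed simp

text \<open>Preserving the first plane kills the lower left block, preserving the second kills the
  upper right one, and the symplectic equation then makes the two diagonal blocks inverse
  transposes.\<close>

lemma Sp4_stabilizer:
  assumes g: "g \<in> carrier Sp4" and 0: "(*v) g ` Lag 0 = Lag 0" and inf: "(*v) g ` Lag_inf = Lag_inf"
  obtains a a' :: mat2 where "a ** a' = mat 1" "g = blk a 0 0 (transpose a')"
proof -
  obtain a b c d where gb: "g = blk a b c d" by (rule blk_cases)
  have "c *v u = 0" for u
  proof -
    have "g *v join u 0 \<in> Lag_inf" using inf by (auto simp: in_Lag_inf_iff)
    then show ?thesis by (simp add: gb blk_mult_join in_Lag_inf_iff)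
  qed
  then have c: "c = 0" by (simp add: matrix_eq)
  have "b *v u = 0" for u
  proof -
    have "g *v join 0 u \<in> Lag 0" using 0 by (auto simp: in_Lag_iff)
    then show ?thesis by (simp add: gb blk_mult_join in_Lag_iff)
  qed
  then have b: "b = 0" by (simp add: matrix_eq)
  have "transpose a ** d = mat 1" using g by (simp add: gb blk_in_Sp4_iff b c matrix_ring_simps)
  then show thesis
    using that[of a "transpose d"] mat2_cancel(4,5)[of "transpose a" d] by (simp add: gb b c)
qed

text \<open>After a cyclic rotation, \<open>l\<close> must be the image of
  \<open>Lag (mat 1)\<close> under the stabilizer of infinity and zero. That stabilizer acts by
  congruence, and the congruence orbit of Id is the set of positive definite matrices.\<close>

lemma maximal_zero_inf_iff: "maximal_triple (Lag 0) l Lag_inf \<longleftrightarrow> (\<exists>X. pd X \<and> l = Lag X)"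
proof
  assume "maximal_triple (Lag 0) l Lag_inf"
  then have "maximal_triple Lag_inf (Lag 0) l" using maximal_triple_rotate by blast
  then obtain g where g: "g \<in> carrier Sp4" "Lag_inf = (*v) g ` Lag_inf" "Lag 0 = (*v) g ` Lag 0"
    "l = (*v) g ` Lag (mat 1)"
    unfolding maximal_triple_iff by blast
  obtain a a' :: mat2 where a: "a ** a' = mat 1" "g = blk a 0 0 (transpose a')"
    using Sp4_stabilizer g by metis
  have "pd (mat 1)" using pd_diag_iff[of 1 1] by (simp add: mk2_simps)
  then have "pd (a ** mat 1 ** transpose a)" using a(1) by (rule pd_conj)
  with g(4) show "\<exists>X. pd X \<and> l = Lag X"
    unfolding a(2) image_glm(2)[OF a(1)] by blast
next
  assume "\<exists>X. pd X \<and> l = Lag X"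
  then obtain X where X: "pd X" "l = Lag X" by blast
  obtain a a' :: mat2 where a: "a ** a' = mat 1" "X = a ** transpose a" using pd_square_root[OF X(1)] .
  have "maximal_triple Lag_inf (Lag 0) (Lag (mat 1))"
    unfolding maximal_triple_iff using one_in_Sp4 by (metis image_one)
  then have "maximal_triple (Lag 0) (Lag (mat 1)) Lag_inf" by (rule maximal_triple_rotate)
  then have "maximal_triple ((*v) (blk a 0 0 (transpose a')) ` Lag 0) ((*v) (blk a 0 0 (transpose a')) ` Lag (mat 1))
     ((*v) (blk a 0 0 (transpose a')) ` Lag_inf)"
    using maximal_triple_image image_glm(1)[OF a(1)] by blast
  then show "maximal_triple (Lag 0) l Lag_inf"
    using a by (simp add: image_glm X(2) matrix_ring_simps)
qed

lemma maximal_inf_iff: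
  assumes "transpose X = X"
  shows "maximal_triple (Lag X) (Lag Y) Lag_inf \<longleftrightarrow> pd (Y - X)"
  using maximal_triple_image[OF image_translation(1)[OF assms], of "Lag 0" "Lag (Y - X)" Lag_inf]
  by (simp add: image_translation assms maximal_zero_inf_iff)

text \<open>A translation and a congruence by a root of \<open>Y - X\<close> bring the triple to (0,
  Id, W), and a rotation makes W = diag(p, q). Inversion then sends it to (inf, -Id, -diag(1/p,
  1/q)), a cyclic rotation of a triple ending at infinity. The proof reads this chain
  backwards.\<close>

lemma maximal_increasing:
  assumes X: "transpose X = X" and XY: "pd (Y - X)" and YZ: "pd (Z - Y)"
  shows "maximal_triple (Lag X) (Lag Y) (Lag Z)"
proof -
  obtain a a' :: mat2 where a: "a ** a' = mat 1" "Y - X = a ** transpose a" using pd_square_root[OF XY] .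
  note ca = mat2_cancel[OF a(1)]
  define W where "W = a' ** (Z - X) ** transpose a'"
  have "pd (Z - X)" using pd_add[OF XY YZ] by simp
  then have W: "pd W" "Z - X = a ** W ** transpose a"
    unfolding W_def using ca by (auto intro!: pd_conj[of _ a' a] simp: matrix_mul_assoc a(1))
  obtain c s p q where cs: "c\<^sup>2 + s\<^sup>2 = 1" and Weq: "W = rot c s ** diag p q ** transpose (rot c s)"
    using spectral[OF pd_symmetric[OF W(1)]] .
  define r where "r = rot c s"
  have r: "r ** transpose r = mat 1" and Wr: "W = r ** diag p q ** transpose r"
    using rot_inverse[OF cs] Weq by (simp_all add: r_def)
  \<comment> \<open>In the new coordinates \<open>Z - Y\<close> is \<open>diag p q - mat 1\<close>,
    so its positivity gives p, q > 1; this makes the inverted triple increasing.\<close>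
  have "Z - Y = a ** (r ** (diag p q - mat 1) ** transpose r) ** transpose a"
  proof -
    have "Z - Y = (Z - X) - (Y - X)" by simp
    also have "\<dots> = a ** (W - mat 1) ** transpose a"
      unfolding W(2) a(2) by (simp add: matrix_ring_simps)
    finally show ?thesis unfolding Wr by (simp add: matrix_ring_simps r)
  qed
  then have "pd (diag p q - mat 1)" using YZ pd_conj_iff[OF a(1)] pd_conj_iff[OF r] by simp
  then have pq: "p > 1" "q > 1" by (simp_all add: mk2_simps pd_diag_iff)
  have "maximal_triple (Lag (- mat 1)) (Lag (- diag (1/p) (1/q))) Lag_inf"
    using pq by (subst maximal_inf_iff) (auto simp: mk2_simps pd_diag_iff)
  then have m: "maximal_triple Lag_inf (Lag (- mat 1)) (Lag (- diag (1/p) (1/q)))"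
    using maximal_triple_rotate by blast
  have 1: "mat 1 ** mat 1 = (mat 1 :: mat2)" by simp
  have 2: "diag p q ** diag (1/p) (1/q) = mat 1" using pq by (simp add: mk2_simps)
  have "maximal_triple (Lag 0) (Lag (mat 1)) (Lag (diag p q))"
    using m maximal_triple_image[OF image_inversion(1)[OF 1], of "Lag 0" "Lag (mat 1)" "Lag (diag p q)"]
    by (simp add: image_inversion[OF 1] image_inversion[OF 2])
  then have "maximal_triple (Lag 0) (Lag (mat 1)) (Lag W)"
    using maximal_triple_image[OF image_glm(1)[OF r], of "Lag 0" "Lag (mat 1)" "Lag (diag p q)"]
    by (simp add: image_glm[OF r, simplified] r matrix_ring_simps flip: Wr)
  then have "maximal_triple (Lag 0) (Lag (Y - X)) (Lag (Z - X))"
    using maximal_triple_image[OF image_glm(1)[OF a(1)], of "Lag 0" "Lag (mat 1)" "Lag W"]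
    by (simp add: image_glm[OF a(1)] a(2) matrix_ring_simps flip: W(2))
  then show ?thesis
    using maximal_triple_image[OF image_translation(1)[OF X], of "Lag 0" "Lag (Y - X)" "Lag (Z - X)"]
    by (simp add: image_translation[OF X])
qed

lemma maximal_tuple_image:
  assumes g: "g \<in> carrier Sp4"
  shows "maximal_tuple (map ((`) ((*v) g)) ls) \<longleftrightarrow> maximal_tuple ls"
  unfolding maximal_tuple_def
  by (auto simp: maximal_triple_image[OF g])

text \<open>Triples ending at infinity are the order relations themselves; the triples of finite
  Lagrangians follow from them by \<open>maximal_increasing\<close>.\<close>

lemma maximal_tuple_iff_increasing:
  assumes sym: "\<And>X. X \<in> set Xs \<Longrightarrow> transpose X = X"
  shows "maximal_tuple (map Lag Xs @ [Lag_inf]) \<longleftrightarrow> sorted_wrt (\<lambda>X Y. pd (Y - X)) Xs"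
proof
  assume m: "maximal_tuple (map Lag Xs @ [Lag_inf])"
  show "sorted_wrt (\<lambda>X Y. pd (Y - X)) Xs"
    unfolding sorted_wrt_iff_nth_less
  proof (intro allI impI)
    fix i j assume ij: "i < j" "j < length Xs"
    then have "maximal_triple (Lag (Xs ! i)) (Lag (Xs ! j)) Lag_inf"
      using m[unfolded maximal_tuple_def, rule_format, of i j "length Xs"] by (simp add: nth_append)
    then show "pd (Xs ! j - Xs ! i)"
      using ij by (simp add: maximal_inf_iff sym)
  qed
next
  assume s: "sorted_wrt (\<lambda>X Y. pd (Y - X)) Xs"
  show "maximal_tuple (map Lag Xs @ [Lag_inf])"
    unfolding maximal_tuple_def
  proof (intro allI impI)
    fix i j k assume ijk: "i < j" "j < k" "k < length (map Lag Xs @ [Lag_inf])"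
    have ij: "pd (Xs ! j - Xs ! i)" using s ijk by (auto simp: sorted_wrt_iff_nth_less)
    show "maximal_triple ((map Lag Xs @ [Lag_inf]) ! i) ((map Lag Xs @ [Lag_inf]) ! j) ((map Lag Xs @ [Lag_inf]) ! k)"
    proof (cases "k < length Xs")
      case True
      then have "pd (Xs ! k - Xs ! j)" using s ijk by (auto simp: sorted_wrt_iff_nth_less)
      then show ?thesis using ijk True ij by (simp add: nth_append maximal_increasing sym)
    next
      case False
      then show ?thesis using ijk ij by (simp add: nth_append maximal_inf_iff sym)
    qed
  qed
qed

section \<open>Generic quadruples\<close>

text \<open>The projection is a definite description, so a decomposition of \<open>x\<close> along
  \<open>l\<close> and \<open>l'\<close> is exhibited; it is unique because the intersection is
  trivial.\<close>

lemma proj_par_image: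
  assumes g: "g \<in> carrier Sp4" and l: "subspace l" "subspace l'" "l \<inter> l' = {0}"
    and y: "y \<in> l" "x - y \<in> l'"
  shows "proj_par ((*v) g ` l) ((*v) g ` l') (g *v x) = g *v y"
  unfolding proj_par_def
proof (rule the_equality)
  show "g *v y \<in> (*v) g ` l \<and> g *v x - g *v y \<in> (*v) g ` l'"
    using y by (auto simp flip: matrix_vector_mult_diff_distrib)
next
  fix y' assume y': "y' \<in> (*v) g ` l \<and> g *v x - y' \<in> (*v) g ` l'"
  then obtain z w where z: "z \<in> l" "y' = g *v z" and w: "w \<in> l'" "g *v x - g *v z = g *v w" by auto
  have "x - z = w"
    using w(2) Sp4_inj[OF g] by (auto simp: inj_eq simp flip: matrix_vector_mult_diff_distrib)
  then have "z - y = (x - y) - w" by (auto simp: algebra_simps)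
  then have "z - y \<in> l'" using subspace_diff[OF l(2) y(2) w(1)] by (simp only:)
  moreover have "z - y \<in> l" using z(1) y(1) by (rule subspace_diff[OF l(1)])
  ultimately have "z - y \<in> l \<inter> l'" by blast
  then show "y' = g *v y" using l(3) z(2) by auto
qed

text \<open>The two projections rest on (0, v) = (-K v, 0) + (K v, v) and (-K v, 0) = (0, K v) + (-K
  v, -K v).\<close>

lemma cross_ratio_diag:
  assumes g: "g \<in> carrier Sp4"
  shows "cross_ratio ((*v) g ` Lag 0) ((*v) g ` Lag (mat 1)) ((*v) g ` Lag K) ((*v) g ` Lag_inf) (g *v join 0 v)
    = g *v join 0 (K *v v)"
proof -
  have 1: "proj_par ((*v) g ` Lag_inf) ((*v) g ` Lag K) (g *v join 0 v) = g *v join (- (K *v v)) 0"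
    by (rule proj_par_image[OF g subspace_Lag_inf subspace_Lag])
      (auto simp: Lag_eq Lag_inf_eq zero_eq_join join_simps)
  have 2: "proj_par ((*v) g ` Lag 0) ((*v) g ` Lag (mat 1)) (g *v join (- (K *v v)) 0) = g *v join 0 (K *v v)"
    by (rule proj_par_image[OF g subspace_Lag subspace_Lag])
      (auto simp: Lag_eq zero_eq_join join_simps)
  have "g *v join 0 v \<in> (*v) g ` Lag 0" by (auto simp: in_Lag_iff)
  then show ?thesis by (simp add: cross_ratio_def 1 2)
qed

text \<open>With z = a + i b and w = x + i y the equations say p w = z w; the sum of squares in the
  proof is |p - z|^2 |w|^2.\<close>

lemma real_eigenvalue:
  fixes a b p x y :: real
  assumes "p * x = a * x - b * y" "p * y = b * x + a * y" "x \<noteq> 0 \<or> y \<noteq> 0"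
  shows "a = p \<and> b = 0"
proof -
  have "((p - a)\<^sup>2 + b\<^sup>2) * (x\<^sup>2 + y\<^sup>2) = (p * x - a * x + b * y)\<^sup>2 + (p * y - b * x - a * y)\<^sup>2"
    by (simp add: power2_eq_square algebra_simps)
  then have "((p - a)\<^sup>2 + b\<^sup>2) * (x\<^sup>2 + y\<^sup>2) = 0" using assms(1,2) by simp
  with assms(3) show ?thesis by (auto simp: sum_power2_eq_zero_iff)
qed

lemma eigenvals_diag:
  assumes g: "g \<in> carrier Sp4"
  shows "eigenvals ((*v) g ` Lag 0)
      (cross_ratio ((*v) g ` Lag 0) ((*v) g ` Lag (mat 1)) ((*v) g ` Lag (diag p q)) ((*v) g ` Lag_inf))
    = {complex_of_real p, complex_of_real q}" (is "eigenvals ?l ?T = _")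
proof -
  have l: "?l = range (\<lambda>v. g *v join 0 v)" by (auto simp: Lag_eq)
  have inj: "g *v x = g *v y \<longleftrightarrow> x = y" for x y
    using Sp4_inj[OF g] by (simp add: inj_eq)
  have "z \<in> eigenvals ?l ?T \<longleftrightarrow> (\<exists>u v. (u \<noteq> 0 \<or> v \<noteq> 0) \<and>
      diag p q *v u = Re z *\<^sub>R u - Im z *\<^sub>R v \<and> diag p q *v v = Im z *\<^sub>R u + Re z *\<^sub>R v)" for z
  proof -
    have 0: "g *v join 0 u = 0 \<longleftrightarrow> u = 0" for u
      using inj[of "join 0 u" 0] by (simp add: join_simps)
    have 1: "a *\<^sub>R (g *v join 0 u) - b *\<^sub>R (g *v join 0 v) = g *v join 0 (a *\<^sub>R u - b *\<^sub>R v)"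
      "b *\<^sub>R (g *v join 0 u) + a *\<^sub>R (g *v join 0 v) = g *v join 0 (b *\<^sub>R u + a *\<^sub>R v)" for a b u v
      by (simp_all only: join_simps scaleR_zero_right diff_self add_0
          flip: matrix_vector_mult_scaleR matrix_vector_mult_diff_distrib matrix_vector_right_distrib)
    have 2: "?T (g *v join 0 u) = g *v join 0 (diag p q *v u)" for u
      by (rule cross_ratio_diag[OF g])
    have "z \<in> eigenvals ?l ?T \<longleftrightarrow> (\<exists>u v. (g *v join 0 u \<noteq> 0 \<or> g *v join 0 v \<noteq> 0) \<and>
      ?T (g *v join 0 u) = Re z *\<^sub>R (g *v join 0 u) - Im z *\<^sub>R (g *v join 0 v) \<and>
      ?T (g *v join 0 v) = Im z *\<^sub>R (g *v join 0 u) + Re z *\<^sub>R (g *v join 0 v))"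
      unfolding eigenvals_def l by blast
    then show ?thesis unfolding 0 1 2 inj join_eq_iff by simp
  qed
  also have "\<dots> z \<longleftrightarrow> z = of_real p \<or> z = of_real q" for z
  proof
    assume "\<exists>u v. (u \<noteq> 0 \<or> v \<noteq> 0) \<and>
      diag p q *v u = Re z *\<^sub>R u - Im z *\<^sub>R v \<and> diag p q *v v = Im z *\<^sub>R u + Re z *\<^sub>R v"
    then obtain u v where "u \<noteq> 0 \<or> v \<noteq> 0"
      "diag p q *v u = Re z *\<^sub>R u - Im z *\<^sub>R v" "diag p q *v v = Im z *\<^sub>R u + Re z *\<^sub>R v" by blast
    then have "(u$1 \<noteq> 0 \<or> v$1 \<noteq> 0) \<or> (u$2 \<noteq> 0 \<or> v$2 \<noteq> 0)"
      "p * u$1 = Re z * u$1 - Im z * v$1" "p * v$1 = Im z * u$1 + Re z * v$1"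
      "q * u$2 = Re z * u$2 - Im z * v$2" "q * v$2 = Im z * u$2 + Re z * v$2"
      by (auto simp: vec_eq_iff forall_2 mk2_simps)
    then show "z = of_real p \<or> z = of_real q"
      using real_eigenvalue[of p "u$1" "Re z" "Im z" "v$1"] real_eigenvalue[of q "u$2" "Re z" "Im z" "v$2"]
      unfolding complex_eq_iff by auto
  next
    assume "z = of_real p \<or> z = of_real q"
    then show "\<exists>u v. (u \<noteq> 0 \<or> v \<noteq> 0) \<and>
      diag p q *v u = Re z *\<^sub>R u - Im z *\<^sub>R v \<and> diag p q *v v = Im z *\<^sub>R u + Re z *\<^sub>R v"
    proof
      assume "z = of_real p"
      then show ?thesis
        by (intro exI[of _ "vector [1, 0]"] exI[of _ 0]) (simp add: vec_eq_iff forall_2 mk2_simps)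
    next
      assume "z = of_real q"
      then show ?thesis
        by (intro exI[of _ "vector [0, 1]"] exI[of _ 0]) (simp add: vec_eq_iff forall_2 mk2_simps)
    qed
  qed
  finally show ?thesis by blast
qed

text \<open>Congruence by \<open>a\<close> followed by \<open>g\<close> carries (0, Id, diag(p, q),
  inf) to this quadruple, whose cross-ratio therefore has eigenvalues p and q. Maximality is stated
  without \<open>g\<close>, under which it is invariant.\<close>

lemma generic_iff:
  assumes g: "g \<in> carrier Sp4" and a: "a ** a' = mat 1"
  shows "generic_quadruple ((*v) g ` Lag 0) ((*v) g ` Lag (a ** transpose a))
      ((*v) g ` Lag (a ** diag p q ** transpose a)) ((*v) g ` Lag_inf) \<longleftrightarrow>
    maximal_tuple (map Lag [0, a ** transpose a, a ** diag p q ** transpose a] @ [Lag_inf]) \<and> p \<noteq> q"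
proof -
  let ?h = "g ** blk a 0 0 (transpose a')"
  have h: "?h \<in> carrier Sp4" using g image_glm(1)[OF a] by (rule mult_in_Sp4)
  have "card {complex_of_real p, complex_of_real q} = 2 \<longleftrightarrow> p \<noteq> q"
    by (auto simp: card_insert_if)
  with eigenvals_diag[OF h, of p q] maximal_tuple_image[OF g, of "map Lag [0, a ** transpose a, a ** diag p q ** transpose a] @ [Lag_inf]"]
  show ?thesis
    by (simp add: generic_quadruple_def image_glm[OF a] matrix_ring_simps flip: image_mult)
qed

section \<open>Hexagons in normal form\<close>

text \<open>Written as a list of matrices followed by infinity so that
  \<open>maximal_tuple_iff_increasing\<close> applies as it stands.\<close>

definition hexagon :: "mat2 \<Rightarrow> mat2 \<Rightarrow> mat2 \<Rightarrow> subsp4 list" where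
  "hexagon A C D = map Lag [0, A, mat 1, C, D] @ [Lag_inf]"

text \<open>Transitivity of the Loewner order reduces the ten pairs among five matrices to the four
  consecutive ones.\<close>

lemma increasing_Cons_Cons:
  "sorted_wrt (\<lambda>X Y. pd (Y - X)) (X # Y # Xs) \<longleftrightarrow> pd (Y - X) \<and> sorted_wrt (\<lambda>X Y. pd (Y - X)) (Y # Xs)"
proof (rule sorted_wrt2)
  show "transp (\<lambda>X Y. pd (Y - X))"
  proof (rule transpI)
    fix X Y Z assume "pd (Y - X)" "pd (Z - Y)"
    then have "pd ((Y - X) + (Z - Y))" by (rule pd_add)
    then show "pd (Z - X)" by simp
  qed
qed

text \<open>Serves both directions: it shows that normal hexagons are generic, and it reads off the
  inequalities for the parameters of a given generic hexagon. Allowing an arbitrary \<open>g\<close>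
  builds in the invariance of \<open>Hgen\<close> that this requires.\<close>

lemma image_hexagon_in_Hgen_iff:
  fixes r s m m' :: mat2
  assumes g: "g \<in> carrier Sp4" and r: "r ** transpose r = mat 1" and s: "s ** transpose s = mat 1"
    and m: "m ** m' = mat 1" and C: "diag p q = m ** transpose m"
    and pos: "\<alpha> > 0" "\<beta> > 0"
  shows "map ((`) ((*v) g)) (hexagon (r ** diag \<alpha> \<beta> ** transpose r) (diag p q)
        (m ** (s ** diag \<delta> \<epsilon> ** transpose s) ** transpose m)) \<in> Hgen \<longleftrightarrow>
    \<alpha> < 1 \<and> \<beta> < 1 \<and> \<alpha> \<noteq> \<beta> \<and> p > 1 \<and> q > 1 \<and> p \<noteq> q \<and> \<delta> > 1 \<and> \<epsilon> > 1 \<and> \<delta> \<noteq> \<epsilon>"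
proof -
  let ?A = "r ** diag \<alpha> \<beta> ** transpose r" and ?C = "diag p q"
  let ?D = "m ** (s ** diag \<delta> \<epsilon> ** transpose s) ** transpose m"
  have pdA: "pd ?A" using pos by (simp add: pd_conj_iff[OF r] pd_diag_iff)
  have "mat 1 - ?A = r ** (mat 1 - diag \<alpha> \<beta>) ** transpose r"
    using r by (simp add: matrix_ring_simps)
  then have 1: "pd (mat 1 - ?A) \<longleftrightarrow> \<alpha> < 1 \<and> \<beta> < 1"
    by (simp add: pd_conj_iff[OF r]) (simp add: mk2_simps pd_diag_iff)
  have 2: "pd (?C - mat 1) \<longleftrightarrow> p > 1 \<and> q > 1"
    by (simp add: mk2_simps pd_diag_iff)
  have "?D - ?C = m ** (s ** (diag \<delta> \<epsilon> - mat 1) ** transpose s) ** transpose m"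
    unfolding C using s by (simp add: matrix_ring_simps(11,12))
  then have 3: "pd (?D - ?C) \<longleftrightarrow> \<delta> > 1 \<and> \<epsilon> > 1"
    by (simp add: pd_conj_iff[OF m] pd_conj_iff[OF s]) (simp add: mk2_simps pd_diag_iff)
  have sym: "transpose X = X" if "X \<in> set [0, ?A, mat 1, ?C, ?D]" for X
    using that by (auto simp: matrix_ring_simps matrix_transpose_mul matrix_mul_assoc mk2_simps(2))
  have max: "maximal_tuple (hexagon ?A ?C ?D) \<longleftrightarrow> sorted_wrt (\<lambda>X Y. pd (Y - X)) [0, ?A, mat 1, ?C, ?D]"
    unfolding hexagon_def using sym by (rule maximal_tuple_iff_increasing)
  have inc: "sorted_wrt (\<lambda>X Y. pd (Y - X)) [0, ?A, mat 1, ?C, ?D] \<longleftrightarrow>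
      \<alpha> < 1 \<and> \<beta> < 1 \<and> p > 1 \<and> q > 1 \<and> \<delta> > 1 \<and> \<epsilon> > 1"
    by (simp only: increasing_Cons_Cons sorted_wrt1 diff_zero pdA 1 2 3) blast
  \<comment> \<open>Congruence by \<open>?a\<close> carries Id to A and diag(1/\<alpha>, 1/\<beta>)
    to Id, so the cross-ratio of the first quadruple has the inverse eigenvalues of A.\<close>
  let ?a = "r ** diag (sqrt \<alpha>) (sqrt \<beta>)"
  have "diag (sqrt \<alpha>) (sqrt \<beta>) ** diag (1 / sqrt \<alpha>) (1 / sqrt \<beta>) = mat 1"
    using pos by (simp add: mk2_simps)
  then have a: "?a ** (diag (1 / sqrt \<alpha>) (1 / sqrt \<beta>) ** transpose r) = mat 1"
    by (simp add: matrix_mul_assoc mat2_cancel(2) r)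
  have da: "transpose ?a = diag (sqrt \<alpha>) (sqrt \<beta>) ** transpose r"
    by (simp add: matrix_transpose_mul mk2_simps(2))
  have D: "diag \<alpha> \<beta> = diag (sqrt \<alpha>) (sqrt \<beta>) ** diag (sqrt \<alpha>) (sqrt \<beta>)"
    using pos by (simp add: mk2_simps)
  have aA: "?a ** transpose ?a = ?A"
    unfolding da D by (simp only: matrix_mul_assoc)
  have "diag (sqrt \<alpha>) (sqrt \<beta>) ** diag (1/\<alpha>) (1/\<beta>) ** diag (sqrt \<alpha>) (sqrt \<beta>) = mat 1"
    using pos by (simp add: mk2_simps)
  moreover have "?a ** diag (1/\<alpha>) (1/\<beta>) ** transpose ?a =
      r ** (diag (sqrt \<alpha>) (sqrt \<beta>) ** diag (1/\<alpha>) (1/\<beta>) ** diag (sqrt \<alpha>) (sqrt \<beta>)) ** transpose r"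
    unfolding da by (simp only: matrix_mul_assoc)
  ultimately have a1: "?a ** diag (1/\<alpha>) (1/\<beta>) ** transpose ?a = mat 1"
    by (simp add: r)
  have gA: "generic_quadruple ((*v) g ` Lag 0) ((*v) g ` Lag ?A) ((*v) g ` Lag (mat 1)) ((*v) g ` Lag_inf) \<longleftrightarrow>
    maximal_tuple (map Lag [0, ?A, mat 1] @ [Lag_inf]) \<and> \<alpha> \<noteq> \<beta>"
    using generic_iff[OF g a, of "1/\<alpha>" "1/\<beta>"] pos unfolding aA a1 by simp
  have gC: "generic_quadruple ((*v) g ` Lag 0) ((*v) g ` Lag (mat 1)) ((*v) g ` Lag ?C) ((*v) g ` Lag_inf) \<longleftrightarrow>
    maximal_tuple (map Lag [0, mat 1, ?C] @ [Lag_inf]) \<and> p \<noteq> q"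
    using generic_iff[OF g, of "mat 1" "mat 1" p q] by simp
  \<comment> \<open>Congruence by \<open>m ** s\<close> carries Id to C, since \<open>s\<close>
    cancels, and diag(\<delta>, \<epsilon>) to D.\<close>
  have ms: "(m ** s) ** (transpose s ** m') = mat 1"
    using m by (simp add: matrix_mul_assoc mat2_cancel(2)[OF s])
  have msT: "(m ** s) ** transpose (m ** s) = ?C" "(m ** s) ** diag \<delta> \<epsilon> ** transpose (m ** s) = ?D"
    unfolding C by (simp_all add: matrix_transpose_mul matrix_mul_assoc mat2_cancel(2)[OF s])
  have gD: "generic_quadruple ((*v) g ` Lag 0) ((*v) g ` Lag ?C) ((*v) g ` Lag ?D) ((*v) g ` Lag_inf) \<longleftrightarrow>
    maximal_tuple (map Lag [0, ?C, ?D] @ [Lag_inf]) \<and> \<delta> \<noteq> \<epsilon>"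
    using generic_iff[OF g ms, of \<delta> \<epsilon>] unfolding msT .
  \<comment> \<open>Genericity of a quadruple includes its maximality, which is inherited from the
    whole hexagon.\<close>
  have sub: "maximal_tuple (map Lag Xs @ [Lag_inf])"
    if "maximal_tuple (hexagon ?A ?C ?D)" "Xs = [0, ?A, mat 1] \<or> Xs = [0, mat 1, ?C] \<or> Xs = [0, ?C, ?D]" for Xs
  proof -
    have "set Xs \<subseteq> set [0, ?A, mat 1, ?C, ?D]" using that(2) by (elim disjE) simp_all
    then have "maximal_tuple (map Lag Xs @ [Lag_inf]) \<longleftrightarrow> sorted_wrt (\<lambda>X Y. pd (Y - X)) Xs"
      using sym by (intro maximal_tuple_iff_increasing) blast
    with that max show ?thesis by auto
  qed
  have "map ((`) ((*v) g)) (hexagon ?A ?C ?D) \<in> Hgen \<longleftrightarrow>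
    maximal_tuple (map ((`) ((*v) g)) (hexagon ?A ?C ?D)) \<and>
    generic_quadruple ((*v) g ` Lag 0) ((*v) g ` Lag ?A) ((*v) g ` Lag (mat 1)) ((*v) g ` Lag_inf) \<and>
    generic_quadruple ((*v) g ` Lag 0) ((*v) g ` Lag (mat 1)) ((*v) g ` Lag ?C) ((*v) g ` Lag_inf) \<and>
    generic_quadruple ((*v) g ` Lag 0) ((*v) g ` Lag ?C) ((*v) g ` Lag ?D) ((*v) g ` Lag_inf)"
    by (simp add: Hgen_def hexagon_def)
  also have "\<dots> \<longleftrightarrow> maximal_tuple (hexagon ?A ?C ?D) \<and> \<alpha> \<noteq> \<beta> \<and> p \<noteq> q \<and> \<delta> \<noteq> \<epsilon>"
    unfolding maximal_tuple_image[OF g] gA gC gD using sub by blast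
  finally show ?thesis unfolding max inc by blast
qed

section \<open>Rotations and the parameters\<close>

lemma SO2_iff: "S \<in> carrier SO2 \<longleftrightarrow> (\<exists>c s. c\<^sup>2 + s\<^sup>2 = 1 \<and> S = rot c s)"
proof
  assume S: "S \<in> carrier SO2"
  obtain a b c d where Se: "S = mk2 a b c d" by (rule mat2_cases)
  have 1: "a * a + c * c = 1" "b * b + d * d = 1" and 2: "a * d - b * c = 1"
    using S unfolding SO2_def rotation_matrix_def orthogonal_matrix_def Se
    by (simp_all add: mk2_simps)
  \<comment> \<open>The right-hand side is the two squared column norms minus twice the determinant,
    that is 1 + 1 - 2.\<close>
  have "(a - d)\<^sup>2 + (b + c)\<^sup>2 = (a * a + c * c) + (b * b + d * d) - 2 * (a * d - b * c)"
    by (simp add: power2_eq_square algebra_simps)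
  then have "(a - d)\<^sup>2 + (b + c)\<^sup>2 = 0" using 1 2 by simp
  then have "d = a" "b = - c" by (auto simp: sum_power2_eq_zero_iff)
  then show "\<exists>c s. c\<^sup>2 + s\<^sup>2 = 1 \<and> S = rot c s"
    using 1 Se by (auto simp: power2_eq_square)
next
  assume "\<exists>c s. c\<^sup>2 + s\<^sup>2 = 1 \<and> S = rot c s"
  then obtain c s where cs: "c\<^sup>2 + s\<^sup>2 = 1" and S: "S = rot c s" by blast
  have "det S = 1" using cs by (simp add: S mk2_simps power2_eq_square)
  then show "S \<in> carrier SO2"
    using rot_inverse[OF cs] by (simp add: SO2_def rotation_matrix_def orthogonal_matrix_def S)
qed

lemma SO2_inverse: "S \<in> carrier SO2 \<Longrightarrow> S ** transpose S = mat 1"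
  by (simp add: SO2_def rotation_matrix_def orthogonal_matrix_def)

lemma transpose_in_SO2: "S \<in> carrier SO2 \<Longrightarrow> transpose S \<in> carrier SO2"
  by (simp add: SO2_def rotation_matrix_def)

lemma SO2_spectral:
  assumes "transpose X = X"
  obtains S p q where "S \<in> carrier SO2" "p \<ge> q" "X = S ** diag p q ** transpose S"
  using spectral[OF assms] SO2_iff by metis

lemma SO2_spectral_unique:
  assumes "S \<in> carrier SO2" "S' \<in> carrier SO2" "p > q" "p' > q'"
    "S ** diag p q ** transpose S = S' ** diag p' q' ** transpose S'"
  shows "p = p' \<and> q = q' \<and> (S' = S \<or> S' = - S)"
proof -
  obtain c s c' s' where "c\<^sup>2 + s\<^sup>2 = 1" "c'\<^sup>2 + s'\<^sup>2 = 1" "S = rot c s" "S' = rot c' s'"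
    using assms(1,2) unfolding SO2_iff by blast
  with assms(3-) show ?thesis using spectral_unique by blast
qed

text \<open>The form required by the spectral lemmas, with rotation \<open>transpose S\<close>. As
  b_1 > b_2, the first diagonal entry is the larger one, as uniqueness demands.\<close>

lemma parA_eq:
  "parA b S = transpose S ** diag (1 / exp (snd b)) (1 / exp (fst b)) ** transpose (transpose S)"
  by (simp add: parA_def)

lemma parA_eq_iff:
  assumes "b \<in> chamber" "b' \<in> chamber" "S \<in> carrier SO2" "S' \<in> carrier SO2"
  shows "parA b S = parA b' S' \<longleftrightarrow> b = b' \<and> (S' = S \<or> S' = - S)"
proof
  assume "parA b S = parA b' S'"
  then have "1 / exp (snd b) = 1 / exp (snd b') \<and> 1 / exp (fst b) = 1 / exp (fst b') \<and>
      (transpose S' = transpose S \<or> transpose S' = - transpose S)"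
    unfolding parA_eq using assms
    by (intro SO2_spectral_unique transpose_in_SO2) (auto simp: chamber_def field_simps)
  then have "exp (snd b) = exp (snd b')" "exp (fst b) = exp (fst b')"
    and "transpose S' = transpose S \<or> transpose S' = transpose (- S)"
    by (auto simp: matrix_ring_simps)
  then have "b = b'" "S' = S \<or> S' = - S"
    by (auto simp: prod_eq_iff dest: arg_cong[of _ _ transpose])
  then show "b = b' \<and> (S' = S \<or> S' = - S)" by blast
next
  assume "b = b' \<and> (S' = S \<or> S' = - S)"
  then show "parA b S = parA b' S'" by (auto simp: parA_def matrix_ring_simps)
qed

text \<open>The diagonal root of \<open>parC c\<close> times the quarter turn
  \<open>mk2 0 1 (-1) 0\<close>, which cancels in \<open>parC_eq\<close>.\<close>

definition sqrtC :: "real \<times> real \<Rightarrow> mat2" where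
  "sqrtC c = mk2 0 (sqrt (exp (fst c))) (- sqrt (exp (snd c))) 0"

lemma sqrtC_inverse:
  "sqrtC c ** mk2 0 (- 1 / sqrt (exp (snd c))) (1 / sqrt (exp (fst c))) 0 = mat 1"
  by (simp add: sqrtC_def mk2_simps)

lemma parC_eq: "parC c = sqrtC c ** transpose (sqrtC c)"
  by (simp add: parC_def sqrtC_def mk2_simps)

lemma parD_eq:
  "parD c d S = sqrtC c ** (S ** diag (exp (fst d)) (exp (snd d)) ** transpose S) ** transpose (sqrtC c)"
  by (simp add: parD_def sqrtC_def matrix_mul_assoc mk2_simps(2))

lemma conj_cancel:
  fixes m m' X Y :: mat2
  assumes "m ** m' = mat 1" "m ** X ** transpose m = m ** Y ** transpose m"
  shows "X = Y"
proof -
  have "m' ** (m ** X ** transpose m) ** transpose m' = m' ** (m ** Y ** transpose m) ** transpose m'"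
    using assms(2) by simp
  then show ?thesis by (simp add: matrix_mul_assoc mat2_cancel[OF assms(1)])
qed

lemma parD_eq_iff:
  assumes "d \<in> chamber" "d' \<in> chamber" "S \<in> carrier SO2" "S' \<in> carrier SO2"
  shows "parD c d S = parD c d' S' \<longleftrightarrow> d = d' \<and> (S' = S \<or> S' = - S)"
proof
  assume "parD c d S = parD c d' S'"
  then have "S ** diag (exp (fst d)) (exp (snd d)) ** transpose S =
      S' ** diag (exp (fst d')) (exp (snd d')) ** transpose S'"
    unfolding parD_eq by (rule conj_cancel[OF sqrtC_inverse])
  then have "exp (fst d) = exp (fst d') \<and> exp (snd d) = exp (snd d') \<and> (S' = S \<or> S' = - S)"
    using assms by (intro SO2_spectral_unique) (auto simp: chamber_def)
  then show "d = d' \<and> (S' = S \<or> S' = - S)" by (auto simp: prod_eq_iff)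
next
  assume "d = d' \<and> (S' = S \<or> S' = - S)"
  then show "parD c d S = parD c d' S'" by (auto simp: parD_eq matrix_ring_simps)
qed

section \<open>Conjugation by the reflection\<close>

text \<open>As \<open>refl_mat\<close> is its own inverse and transpose, this is both conjugation
  and congruence. On rotations it is inversion, on diagonal matrices the identity.\<close>

definition rconj :: "mat2 \<Rightarrow> mat2" where
  "rconj S = refl_mat ** S ** refl_mat"

lemma rconj_mk2: "rconj (mk2 x y z w) = mk2 x (- y) (- z) w"
  by (simp add: rconj_def refl_mat_def mk2_simps)

lemma rconj_rconj [simp]: "rconj (rconj S) = S"
  by (cases S rule: mat2_cases) (simp add: rconj_mk2)

lemma rconj_uminus: "rconj (- S) = - rconj S"
  by (simp add: rconj_def matrix_ring_simps)

lemma rconj_in_SO2: "S \<in> carrier SO2 \<Longrightarrow> rconj S \<in> carrier SO2"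
proof -
  assume "S \<in> carrier SO2"
  then obtain c s where "c\<^sup>2 + s\<^sup>2 = 1" "S = rot c s" unfolding SO2_iff by blast
  then have "c\<^sup>2 + (- s)\<^sup>2 = 1 \<and> rconj S = rot c (- s)" by (simp add: rconj_mk2)
  then show ?thesis unfolding SO2_iff by blast
qed

lemma rconj_mult: "rconj (A ** B) = rconj A ** rconj B"
  by (cases A rule: mat2_cases; cases B rule: mat2_cases) (simp add: rconj_mk2 mk2_simps(1))

lemma rconj_transpose: "rconj (transpose A) = transpose (rconj A)"
  by (cases A rule: mat2_cases) (simp add: rconj_mk2 mk2_simps(2))

lemma parA_rconj: "parA b (rconj S) = rconj (parA b S)"
  by (simp add: parA_def rconj_mult rconj_transpose rconj_mk2)

lemma parC_rconj: "rconj (parC c) = parC c"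
  by (simp add: parC_def rconj_mk2)

text \<open>The reflection changes the sign of \<open>sqrtC c\<close>, which occurs twice in
  \<open>parD\<close>, so the signs cancel.\<close>

lemma parD_rconj: "parD c d (rconj S) = rconj (parD c d S)"
proof -
  have "rconj (sqrtC c) = - sqrtC c" by (simp add: sqrtC_def rconj_mk2 mk2_simps)
  then show ?thesis
    by (simp add: parD_eq rconj_mult rconj_transpose matrix_ring_simps) (simp add: rconj_mk2)
qed

section \<open>Orbits of hexagons\<close>

text \<open>A coset is {g, -g}, and -g = g (-Id) has the same effect on a subspace; orbits can thus
  be computed with representatives.\<close>

lemma orbit_subspaces:
  assumes "\<And>l. l \<in> set ls \<Longrightarrow> subspace l"
  shows "orbit PSp4 PSp4_act ls = {map ((`) ((*v) g)) ls | g. g \<in> carrier Sp4}"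
proof -
  have 1: "carrier PSp4 = {{g, - g} | g. g \<in> carrier Sp4}"
    by (auto simp: PSp4_def FactGroup_def RCOSETS_def r_coset_def Sp4_def mat4_minus_mult)
  have 2: "(*v) (- g) ` l = (*v) g ` l" if "subspace l" for g :: mat4 and l
  proof -
    have m: "(- g) *v x = g *v (- x)" for x
      by (simp add: vec_eq_iff matrix_vector_mult_def sum_negf)
    show ?thesis
    proof (intro equalityI subsetI)
      fix y assume "y \<in> (*v) (- g) ` l"
      then show "y \<in> (*v) g ` l" using m subspace_neg[OF that] by auto
    next
      fix y assume "y \<in> (*v) g ` l"
      then obtain x where "x \<in> l" "y = g *v x" by blast
      then have "y = (- g) *v (- x)" "- x \<in> l" using m subspace_neg[OF that] by auto
      then show "y \<in> (*v) (- g) ` l" by blast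
    qed
  qed
  have 3: "map ((`) ((*v) g)) ls = PSp4_act {g, - g} ls" for g
    unfolding PSp4_act_def using assms by (auto simp: 2)
  show ?thesis unfolding orbit_def 1 3 by blast
qed

definition normal_hexagon ::
  "real \<times> real \<Rightarrow> real \<times> real \<Rightarrow> real \<times> real \<Rightarrow> mat2 \<Rightarrow> mat2 \<Rightarrow> subsp4 list" where
  "normal_hexagon b c d S1 S2 = hexagon (parA b S1) (parC c) (parD c d S2)"

lemma orbit_hexagon:
  "orbit PSp4 PSp4_act (hexagon A C D) = {map ((`) ((*v) g)) (hexagon A C D) | g. g \<in> carrier Sp4}"
  by (rule orbit_subspaces) (auto simp: hexagon_def subspace_Lag subspace_Lag_inf)

lemma image_normal_hexagon_in_Hgen:
  assumes g: "g \<in> carrier Sp4" and S1: "S1 \<in> carrier SO2" and S2: "S2 \<in> carrier SO2"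
    and "b \<in> chamber" "c \<in> chamber" "d \<in> chamber"
  shows "map ((`) ((*v) g)) (normal_hexagon b c d S1 S2) \<in> Hgen"
proof -
  have r: "transpose S1 ** transpose (transpose S1) = mat 1"
    using SO2_inverse[OF transpose_in_SO2[OF S1]] .
  have C: "diag (exp (fst c)) (exp (snd c)) = sqrtC c ** transpose (sqrtC c)"
    using parC_eq[of c] by (simp add: parC_def)
  show ?thesis
    unfolding normal_hexagon_def parA_eq parD_eq parC_def
    by (subst image_hexagon_in_Hgen_iff[OF g r SO2_inverse[OF S2] sqrtC_inverse C])
      (use assms in \<open>auto simp: chamber_def\<close>)
qed

lemma maximal_image_zero_inf:
  assumes g: "g \<in> carrier Sp4" and m: "maximal_triple ((*v) g ` Lag 0) l ((*v) g ` Lag_inf)"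
  obtains X where "pd X" "l = (*v) g ` Lag X"
proof -
  obtain h where h: "h \<in> carrier Sp4" "h ** g = mat 1" "g ** h = mat 1" using Sp4_inverse[OF g] .
  have "maximal_triple ((*v) h ` ((*v) g ` Lag 0)) ((*v) h ` l) ((*v) h ` ((*v) g ` Lag_inf))"
    using m maximal_triple_image[OF h(1)] by blast
  then have "maximal_triple (Lag 0) ((*v) h ` l) Lag_inf"
    unfolding image_mult h(2) by simp
  then obtain X where X: "pd X" "(*v) h ` l = Lag X" using maximal_zero_inf_iff by blast
  have "l = (*v) g ` ((*v) h ` l)" by (simp only: image_mult h(3) image_one)
  with X that show thesis by metis
qed

lemma Hgen_normal_form:
  assumes "x \<in> Hgen"
  obtains g b c d S1 S2 where "g \<in> carrier Sp4" "b \<in> chamber" "c \<in> chamber" "d \<in> chamber"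
    "S1 \<in> carrier SO2" "S2 \<in> carrier SO2" "x = map ((`) ((*v) g)) (normal_hexagon b c d S1 S2)"
proof -
  obtain P A B C D Q where x: "x = [P, A, B, C, D, Q]" and max: "maximal_tuple [P, A, B, C, D, Q]"
    using assms unfolding Hgen_def by blast
  have "maximal_triple P A Q" "maximal_triple P B Q" "maximal_triple P C Q" "maximal_triple P D Q"
    using max[unfolded maximal_tuple_def, rule_format, of 0 1 5] max[unfolded maximal_tuple_def, rule_format, of 0 2 5]
      max[unfolded maximal_tuple_def, rule_format, of 0 3 5] max[unfolded maximal_tuple_def, rule_format, of 0 4 5]
    by simp_all
  note m = this
  \<comment> \<open>Two cyclic rotations bring the triple to the order (Q, P, B) of the standard one
    (infinity, zero, Id).\<close>
  obtain g0 where g0: "g0 \<in> carrier Sp4" "Q = (*v) g0 ` Lag_inf" "P = (*v) g0 ` Lag 0" "B = (*v) g0 ` Lag (mat 1)"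
    using maximal_triple_rotate[OF maximal_triple_rotate[OF m(2)]] unfolding maximal_triple_iff by blast
  obtain A0 where A0: "pd A0" "A = (*v) g0 ` Lag A0" using maximal_image_zero_inf[OF g0(1)] m(1) g0 by metis
  obtain C0 where C0: "pd C0" "C = (*v) g0 ` Lag C0" using maximal_image_zero_inf[OF g0(1)] m(3) g0 by metis
  obtain D0 where D0: "pd D0" "D = (*v) g0 ` Lag D0" using maximal_image_zero_inf[OF g0(1)] m(4) g0 by metis
  obtain r p q where r: "r \<in> carrier SO2" and pq: "p \<ge> q" and C0r: "C0 = r ** diag p q ** transpose r"
    using SO2_spectral[OF pd_symmetric[OF C0(1)]] .
  note rr = SO2_inverse[OF r]
  note rT = SO2_inverse[OF transpose_in_SO2[OF r]]
  \<comment> \<open>The remaining orthogonal freedom is spent on diagonalizing C; A and D are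
    rewritten in the same basis.\<close>
  define g where "g = g0 ** blk r 0 0 (transpose (transpose r))"
  have g: "g \<in> carrier Sp4" unfolding g_def using g0(1) image_glm(1)[OF rr] by (rule mult_in_Sp4)
  define A1 D1 where "A1 = transpose r ** A0 ** transpose (transpose r)" "D1 = transpose r ** D0 ** transpose (transpose r)"
  have A1: "pd A1" and D1: "pd D1"
    unfolding A1_D1_def using A0(1) D0(1) rT by (blast intro: pd_conj)+
  have A0r: "A0 = r ** A1 ** transpose r" and D0r: "D0 = r ** D1 ** transpose r"
    by (simp_all add: A1_D1_def matrix_mul_assoc rr mat2_cancel(3)[OF rr, simplified] mat2_cancel(2)[OF rr])
  have x1: "x = map ((`) ((*v) g)) (hexagon A1 (diag p q) D1)"
    by (simp add: x hexagon_def g0 A0 C0 D0 A0r C0r D0r g_def image_glm[OF rr] matrix_ring_simps rr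
        del: transpose_transpose flip: image_mult)
  have pd_pq: "p > 0" "q > 0" using C0(1) unfolding C0r pd_conj_iff[OF rr] pd_diag_iff by auto
  define c where "c = (ln p, ln q)"
  have c: "exp (fst c) = p" "exp (snd c) = q" using pd_pq by (simp_all add: c_def)
  obtain s \<alpha> \<beta> where s: "s \<in> carrier SO2" and ab: "\<alpha> \<ge> \<beta>" and A1s: "A1 = s ** diag \<alpha> \<beta> ** transpose s"
    using SO2_spectral[OF pd_symmetric[OF A1]] .
  have pd_ab: "\<alpha> > 0" "\<beta> > 0" using A1 unfolding A1s pd_conj_iff[OF SO2_inverse[OF s]] pd_diag_iff by auto
  \<comment> \<open>D is diagonalized only after \<open>m'\<close> has turned C into Id, so that
    \<delta> and \<epsilon> are the eigenvalues of C^-1 D.\<close>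
  obtain m' where m': "sqrtC c ** m' = mat 1" using sqrtC_inverse by blast
  have "transpose (m' ** D1 ** transpose m') = m' ** D1 ** transpose m'"
    using pd_symmetric[OF D1] by (simp add: matrix_transpose_mul matrix_mul_assoc)
  then obtain t \<delta> \<epsilon> where t: "t \<in> carrier SO2" and de: "\<delta> \<ge> \<epsilon>" and
    D1t: "m' ** D1 ** transpose m' = t ** diag \<delta> \<epsilon> ** transpose t"
    using SO2_spectral by metis
  have D1m: "D1 = sqrtC c ** (t ** diag \<delta> \<epsilon> ** transpose t) ** transpose (sqrtC c)"
    unfolding D1t[symmetric] by (simp add: matrix_mul_assoc m' mat2_cancel(5-7)[OF m'])
  have C: "diag p q = sqrtC c ** transpose (sqrtC c)"
    using parC_eq[of c] by (simp add: parC_def c)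
  have "\<alpha> < 1 \<and> \<beta> < 1 \<and> \<alpha> \<noteq> \<beta> \<and> p > 1 \<and> q > 1 \<and> p \<noteq> q \<and> \<delta> > 1 \<and> \<epsilon> > 1 \<and> \<delta> \<noteq> \<epsilon>"
    using assms unfolding x1 A1s D1m
    by (subst (asm) image_hexagon_in_Hgen_iff[OF g SO2_inverse[OF s] SO2_inverse[OF t] m' C pd_ab])
  with pq ab de have gt: "\<beta> < \<alpha>" "\<alpha> < 1" "q < p" "1 < q" "\<epsilon> < \<delta>" "1 < \<epsilon>" by auto
  \<comment> \<open>The larger eigenvalue \<alpha> of A gives the smaller parameter b_2.\<close>
  define b d where "b = (- ln \<beta>, - ln \<alpha>)" "d = (ln \<delta>, ln \<epsilon>)"
  have "b \<in> chamber" "c \<in> chamber" "d \<in> chamber"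
    using gt pd_ab by (auto simp: chamber_def b_d_def c_def)
  moreover have "A1 = parA b (transpose s)"
    using pd_ab by (simp add: A1s parA_def b_d_def exp_minus field_simps)
  moreover have "D1 = parD c d t"
    using gt by (simp add: D1m parD_eq b_d_def)
  moreover have "diag p q = parC c" by (simp add: parC_def c)
  ultimately show thesis
    using that[of g b c d "transpose s" t] g x1 transpose_in_SO2[OF s] t by (simp add: normal_hexagon_def)
qed

section \<open>When two normal hexagons lie in one orbit\<close>

text \<open>An orthogonal matrix intertwining two diagonal matrices with distinct entries maps axes
  to axes; the common ordering of the entries forbids the swap and leaves only signs.\<close>

lemma commute_diag_cases:
  fixes a :: mat2
  assumes aa: "a ** transpose a = mat 1" and eq: "a ** diag p q ** transpose a = diag p' q'"
    and "p > q" "p' > q'"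
  shows "p = p' \<and> q = q' \<and> (a = mat 1 \<or> a = - mat 1 \<or> a = refl_mat \<or> a = - refl_mat)"
proof -
  obtain x y z w where a: "a = mk2 x y z w" by (rule mat2_cases)
  have "a ** diag p q = a ** diag p q ** transpose a ** a"
    using mat2_cancel(3)[OF aa] by simp
  also have "\<dots> = diag p' q' ** a" by (simp only: eq)
  finally have 1: "x * p = p' * x" "y * q = p' * y" "z * p = q' * z" "w * q = q' * w"
    unfolding a by (simp_all add: mk2_simps)
  have 2: "x * x + y * y = 1" "z * z + w * w = 1" "x * z + y * w = 0"
    using aa unfolding a by (simp_all add: mk2_simps)
  \<comment> \<open>If x vanished, \<open>a\<close> would exchange the axes and hence the
    eigenvalues.\<close>
  have "x \<noteq> 0"
  proof
    assume "x = 0"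
    with 2 have "y \<noteq> 0" "w = 0" by auto
    with 2 have "z \<noteq> 0" by auto
    with \<open>y \<noteq> 0\<close> 1 have "q = p'" "p = q'" by auto
    with assms show False by auto
  qed
  with 1 have p: "p = p'" by simp
  with 1 assms have y: "y = 0" by auto
  with 2 \<open>x \<noteq> 0\<close> have z: "z = 0" by auto
  with 2 have "w \<noteq> 0" by auto
  with 1 have q: "q = q'" by simp
  have "x = 1 \<or> x = - 1" "w = 1 \<or> w = - 1"
    using 2 y z by (simp_all add: square_eq_1_iff)
  with p q y z show ?thesis by (auto simp: a mk2_simps refl_mat_def)
qed

lemma normal_hexagon_same_orbit_iff:
  assumes bcd: "b \<in> chamber" "c \<in> chamber" "d \<in> chamber" "b' \<in> chamber" "c' \<in> chamber" "d' \<in> chamber"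
    and S: "S1 \<in> carrier SO2" "S2 \<in> carrier SO2" "S1' \<in> carrier SO2" "S2' \<in> carrier SO2"
  shows "(\<exists>g\<in>carrier Sp4. normal_hexagon b' c' d' S1' S2' = map ((`) ((*v) g)) (normal_hexagon b c d S1 S2)) \<longleftrightarrow>
    b = b' \<and> c = c' \<and> d = d' \<and>
    ((S1' = S1 \<or> S1' = - S1) \<and> (S2' = S2 \<or> S2' = - S2) \<or>
     (S1' = rconj S1 \<or> S1' = - rconj S1) \<and> (S2' = rconj S2 \<or> S2' = - rconj S2))"
proof
  assume "\<exists>g\<in>carrier Sp4. normal_hexagon b' c' d' S1' S2' = map ((`) ((*v) g)) (normal_hexagon b c d S1 S2)"
  then obtain g where g: "g \<in> carrier Sp4" "(*v) g ` Lag 0 = Lag 0" "(*v) g ` Lag_inf = Lag_inf"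
    "(*v) g ` Lag (mat 1) = Lag (mat 1)" and
    A: "(*v) g ` Lag (parA b S1) = Lag (parA b' S1')" and C: "(*v) g ` Lag (parC c) = Lag (parC c')" and
    D: "(*v) g ` Lag (parD c d S2) = Lag (parD c' d' S2')"
    by (auto simp: normal_hexagon_def hexagon_def)
  obtain a a' :: mat2 where a: "a ** a' = mat 1" "g = blk a 0 0 (transpose a')"
    using Sp4_stabilizer[OF g(1-3)] .
  note gl = image_glm(2)[OF a(1), folded a(2)]
  have aa: "a ** transpose a = mat 1" using g(4) unfolding gl by simp
  have C': "a ** parC c ** transpose a = parC c'" using C unfolding gl by simp
  have A': "a ** parA b S1 ** transpose a = parA b' S1'" using A unfolding gl by simp
  have D': "a ** parD c d S2 ** transpose a = parD c' d' S2'" using D unfolding gl by simp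
  have "exp (fst c) = exp (fst c') \<and> exp (snd c) = exp (snd c') \<and>
      (a = mat 1 \<or> a = - mat 1 \<or> a = refl_mat \<or> a = - refl_mat)"
    using aa C' bcd unfolding parC_def by (intro commute_diag_cases) (auto simp: chamber_def)
  then have cc: "c = c'" and a4: "a = mat 1 \<or> a = - mat 1 \<or> a = refl_mat \<or> a = - refl_mat"
    by (auto simp: prod_eq_iff)
  have "transpose refl_mat = refl_mat" by (simp add: refl_mat_def mk2_simps)
  \<comment> \<open>The sign of \<open>a\<close> is lost in the congruence, so the four cases are
    two.\<close>
  with a4 have "(\<forall>X. a ** X ** transpose a = X) \<or> (\<forall>X. a ** X ** transpose a = rconj X)"
    by (auto simp: matrix_ring_simps rconj_def)
  then show "b = b' \<and> c = c' \<and> d = d' \<and>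
    ((S1' = S1 \<or> S1' = - S1) \<and> (S2' = S2 \<or> S2' = - S2) \<or>
     (S1' = rconj S1 \<or> S1' = - rconj S1) \<and> (S2' = rconj S2 \<or> S2' = - rconj S2))"
  proof
    assume X: "\<forall>X. a ** X ** transpose a = X"
    have "parA b S1 = parA b' S1'" "parD c d S2 = parD c d' S2'" using A' D' cc X by auto
    then show ?thesis
      using cc parA_eq_iff[OF bcd(1,4) S(1,3)] parD_eq_iff[OF bcd(3,6) S(2,4)] by blast
  next
    assume X: "\<forall>X. a ** X ** transpose a = rconj X"
    have "parA b (rconj S1) = parA b' S1'" "parD c d (rconj S2) = parD c d' S2'"
      unfolding parA_rconj parD_rconj using A' D' cc X by auto
    then show ?thesis
      using cc parA_eq_iff[OF bcd(1,4) rconj_in_SO2[OF S(1)] S(3)]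
        parD_eq_iff[OF bcd(3,6) rconj_in_SO2[OF S(2)] S(4)] by blast
  qed
next
  assume R: "b = b' \<and> c = c' \<and> d = d' \<and>
    ((S1' = S1 \<or> S1' = - S1) \<and> (S2' = S2 \<or> S2' = - S2) \<or>
     (S1' = rconj S1 \<or> S1' = - rconj S1) \<and> (S2' = rconj S2 \<or> S2' = - rconj S2))"
  then have e: "b' = b" "c' = c" "d' = d" by auto
  from R have "parA b S1 = parA b S1' \<and> parD c d S2 = parD c d S2' \<or>
      parA b (rconj S1) = parA b S1' \<and> parD c d (rconj S2) = parD c d S2'"
    using parA_eq_iff[OF bcd(1,1) S(1,3)] parD_eq_iff[OF bcd(3,3) S(2,4)]
      parA_eq_iff[OF bcd(1,1) rconj_in_SO2[OF S(1)] S(3)]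
      parD_eq_iff[OF bcd(3,3) rconj_in_SO2[OF S(2)] S(4)] by blast
  then have "parA b S1' = parA b S1 \<and> parD c d S2' = parD c d S2 \<or>
      parA b S1' = rconj (parA b S1) \<and> parD c d S2' = rconj (parD c d S2)"
    unfolding parA_rconj parD_rconj by (elim disjE conjE) simp_all
  then show "\<exists>g\<in>carrier Sp4. normal_hexagon b' c' d' S1' S2' = map ((`) ((*v) g)) (normal_hexagon b c d S1 S2)"
  proof
    assume "parA b S1' = parA b S1 \<and> parD c d S2' = parD c d S2"
    then show ?thesis using one_in_Sp4
      by (intro bexI[of _ "mat 1"]) (simp_all add: normal_hexagon_def hexagon_def e)
  next
    assume r: "parA b S1' = rconj (parA b S1) \<and> parD c d S2' = rconj (parD c d S2)"
    have rr: "refl_mat ** refl_mat = mat 1" "transpose refl_mat = refl_mat"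
      by (simp_all add: refl_mat_def mk2_simps)
    have r0: "rconj 0 = 0" "rconj (mat 1) = mat 1"
      by (simp_all add: mk2_simps(6,7) rconj_mk2)
    show ?thesis
      using image_glm(1)[OF rr(1)] image_glm(2,3)[OF rr(1)] r
      by (intro bexI[of _ "blk refl_mat 0 0 (transpose refl_mat)"])
        (simp_all add: normal_hexagon_def hexagon_def e rr r0 parC_rconj flip: rconj_def)
  qed
qed

lemma orbit_image_hexagon:
  assumes g: "g \<in> carrier Sp4"
  shows "orbit PSp4 PSp4_act (map ((`) ((*v) g)) (hexagon A C D)) = orbit PSp4 PSp4_act (hexagon A C D)"
proof -
  define N where N: "N = hexagon A C D"
  have mult: "map ((`) ((*v) k)) (map ((`) ((*v) g)) M) = map ((`) ((*v) (k ** g))) M" for k g M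
    by (simp add: image_mult)
  have "orbit PSp4 PSp4_act (map ((`) ((*v) g)) N) = {map ((`) ((*v) k)) (map ((`) ((*v) g)) N) | k. k \<in> carrier Sp4}"
    by (rule orbit_subspaces) (auto simp: N hexagon_def subspace_Lag subspace_Lag_inf intro!: subspace_image)
  also have "\<dots> = {map ((`) ((*v) k)) N | k. k \<in> carrier Sp4}"
  proof (intro equalityI subsetI)
    fix x assume "x \<in> {map ((`) ((*v) k)) (map ((`) ((*v) g)) N) | k. k \<in> carrier Sp4}"
    then obtain k where k: "k \<in> carrier Sp4" "x = map ((`) ((*v) (k ** g))) N" unfolding mult by blast
    then show "x \<in> {map ((`) ((*v) k)) N | k. k \<in> carrier Sp4}"
      using mult_in_Sp4[OF k(1) g] by blast
  next
    fix x assume "x \<in> {map ((`) ((*v) k)) N | k. k \<in> carrier Sp4}"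
    then obtain k where k: "k \<in> carrier Sp4" "x = map ((`) ((*v) k)) N" by blast
    obtain h where h: "h \<in> carrier Sp4" "h ** g = mat 1" using Sp4_inverse[OF g] by blast
    have "k ** h ** g = k" using h(2) by (simp flip: matrix_mul_assoc)
    then have "x = map ((`) ((*v) (k ** h))) (map ((`) ((*v) g)) N)" unfolding mult k(2) by simp
    then show "x \<in> {map ((`) ((*v) k)) (map ((`) ((*v) g)) N) | k. k \<in> carrier Sp4}"
      using mult_in_Sp4[OF k(1) h(1)] by blast
  qed
  finally show ?thesis unfolding N orbit_hexagon .
qed

lemma orbit_hexagon_eq_iff:
  "orbit PSp4 PSp4_act (hexagon A C D) = orbit PSp4 PSp4_act (hexagon A' C' D') \<longleftrightarrow>
    (\<exists>g\<in>carrier Sp4. hexagon A' C' D' = map ((`) ((*v) g)) (hexagon A C D))"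
proof
  assume eq: "orbit PSp4 PSp4_act (hexagon A C D) = orbit PSp4 PSp4_act (hexagon A' C' D')"
  have "hexagon A' C' D' = map ((`) ((*v) (mat 1))) (hexagon A' C' D')"
    by (simp add: map_idI)
  then have "hexagon A' C' D' \<in> orbit PSp4 PSp4_act (hexagon A' C' D')"
    unfolding orbit_hexagon using one_in_Sp4 by blast
  then show "\<exists>g\<in>carrier Sp4. hexagon A' C' D' = map ((`) ((*v) g)) (hexagon A C D)"
    unfolding eq[symmetric] unfolding orbit_hexagon by blast
qed (auto simp: orbit_image_hexagon)

section \<open>The parameter space\<close>

lemma PSO2_class_eq: "PSO2_class S = {S, - S}"
  by (auto simp: PSO2_class_def r_coset_def SO2_def matrix_ring_simps)

lemma PSO2_class_eq_iff: "PSO2_class S' = PSO2_class S \<longleftrightarrow> S' = S \<or> S' = - S"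
  unfolding PSO2_class_eq by (auto simp: doubleton_eq_iff)

lemma carrier_PSO2: "carrier PSO2 = PSO2_class ` carrier SO2"
  by (auto simp: PSO2_def FactGroup_def RCOSETS_def PSO2_class_def)

lemma conj_r_class: "conj_r (PSO2_class S) = PSO2_class (rconj S)"
  by (simp add: conj_r_def PSO2_class_eq rconj_uminus flip: rconj_def)

lemma conj_r_conj_r:
  assumes "K \<in> carrier PSO2"
  shows "conj_r K \<in> carrier PSO2" "conj_r (conj_r K) = K"
  using assms by (auto simp: carrier_PSO2 conj_r_class rconj_in_SO2)

lemma equiv_PSO2_rel: "equiv (carrier PSO2 \<times> carrier PSO2) PSO2_rel"
proof (rule equivI)
  show "PSO2_rel \<subseteq> (carrier PSO2 \<times> carrier PSO2) \<times> (carrier PSO2 \<times> carrier PSO2)"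
    by (auto simp: PSO2_rel_def conj_r_conj_r)
  show "refl_on (carrier PSO2 \<times> carrier PSO2) PSO2_rel"
    by (auto simp: refl_on_def PSO2_rel_def)
  show "sym PSO2_rel"
    by (rule symI) (auto simp: PSO2_rel_def conj_r_conj_r)
  show "trans PSO2_rel"
    by (rule transI) (auto simp: PSO2_rel_def conj_r_conj_r)
qed

lemma PSO2_rel_class_eq_iff:
  assumes "S1 \<in> carrier SO2" "S2 \<in> carrier SO2" "S1' \<in> carrier SO2" "S2' \<in> carrier SO2"
  shows "PSO2_rel `` {(PSO2_class S1, PSO2_class S2)} = PSO2_rel `` {(PSO2_class S1', PSO2_class S2')} \<longleftrightarrow>
    (S1' = S1 \<or> S1' = - S1) \<and> (S2' = S2 \<or> S2' = - S2) \<or>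
    (S1' = rconj S1 \<or> S1' = - rconj S1) \<and> (S2' = rconj S2 \<or> S2' = - rconj S2)"
proof -
  have carrier: "(PSO2_class S1, PSO2_class S2) \<in> carrier PSO2 \<times> carrier PSO2"
    "(PSO2_class S1', PSO2_class S2') \<in> carrier PSO2 \<times> carrier PSO2"
    using assms by (auto simp: carrier_PSO2)
  then have "((PSO2_class S1, PSO2_class S2), (PSO2_class S1', PSO2_class S2')) \<in> PSO2_rel \<longleftrightarrow>
      PSO2_class S1' = PSO2_class S1 \<and> PSO2_class S2' = PSO2_class S2 \<or>
      PSO2_class S1' = PSO2_class (rconj S1) \<and> PSO2_class S2' = PSO2_class (rconj S2)"
    by (simp add: PSO2_rel_def conj_r_class)
  then show ?thesis
    unfolding eq_equiv_class_iff[OF equiv_PSO2_rel carrier] PSO2_class_eq_iff .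
qed

lemma quotient_PSO2_rel:
  "(carrier PSO2 \<times> carrier PSO2) // PSO2_rel =
    (\<lambda>(S1, S2). PSO2_rel `` {(PSO2_class S1, PSO2_class S2)}) ` (carrier SO2 \<times> carrier SO2)"
  by (auto simp: quotient_def carrier_PSO2)

section \<open>Angles\<close>

text \<open>The representative of -\<alpha> modulo 2 pi in the half-open interval; zero is separate
  because 2 pi - 0 falls outside.\<close>

definition reverse_angle :: "real \<Rightarrow> real" where
  "reverse_angle \<alpha> = (if \<alpha> = 0 then 0 else 2 * pi - \<alpha>)"

lemma reverse_angle_in: "\<alpha> \<in> {0..<2*pi} \<Longrightarrow> reverse_angle \<alpha> \<in> {0..<2*pi}"
  by (auto simp: reverse_angle_def)

lemma rcong_reverse_angle:
  assumes "\<alpha> \<in> {0..<2*pi}" "\<beta> \<in> {0..<2*pi}"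
  shows "[\<beta> = 2 * pi - \<alpha>] (rmod (2 * pi)) \<longleftrightarrow> \<beta> = reverse_angle \<alpha>"
proof -
  have "(2 * pi - \<alpha>) rmod (2 * pi) = reverse_angle \<alpha>"
  proof (cases "\<alpha> = 0")
    case True
    then show ?thesis using rmod_self[of "2 * pi"] by (simp add: reverse_angle_def)
  next
    case False
    then show ?thesis using assms(1) by (simp add: reverse_angle_def rmod_idem)
  qed
  moreover have "\<beta> rmod (2 * pi) = \<beta>" using assms(2) by (simp add: rmod_idem)
  ultimately show ?thesis by (simp add: rcong_def)
qed

lemma angle_rel_iff:
  "((\<alpha>1, \<alpha>2), (\<beta>1, \<beta>2)) \<in> angle_rel \<longleftrightarrow> (\<alpha>1, \<alpha>2) \<in> angles \<and>
    ((\<beta>1, \<beta>2) = (\<alpha>1, \<alpha>2) \<or> (\<beta>1, \<beta>2) = (reverse_angle \<alpha>1, reverse_angle \<alpha>2))"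
  unfolding angle_rel_def angles_def
  using rcong_reverse_angle reverse_angle_in by auto

lemma equiv_angle_rel: "equiv angles angle_rel"
proof (rule equivI)
  show "angle_rel \<subseteq> angles \<times> angles"
    by (auto simp: angle_rel_def)
  show "refl_on angles angle_rel"
    by (auto simp: refl_on_def angle_rel_iff)
  show "sym angle_rel"
    by (rule symI) (auto simp: angle_rel_iff angles_def reverse_angle_def split: if_splits)
  show "trans angle_rel"
    by (rule transI) (auto simp: angle_rel_iff angles_def reverse_angle_def split: if_splits)
qed

lemma half_rot_in_SO2: "half_rot \<alpha> \<in> carrier SO2"
proof -
  have "(cos (\<alpha>/2))\<^sup>2 + (sin (\<alpha>/2))\<^sup>2 = 1" by simp
  then show ?thesis unfolding SO2_iff half_rot_def by blast
qed

text \<open>For \<alpha> nonzero the half angle becomes pi - \<alpha>/2, which gives minus the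
  inverse rotation; for \<alpha> = 0 there is no sign. In PSO(2) both cases are conjugation by the
  reflection.\<close>

lemma half_rot_reverse: "half_rot (reverse_angle \<alpha>) = rconj (half_rot \<alpha>) \<or> half_rot (reverse_angle \<alpha>) = - rconj (half_rot \<alpha>)"
proof (cases "\<alpha> = 0")
  case True
  then show ?thesis by (simp add: reverse_angle_def half_rot_def rconj_mk2)
next
  case False
  have "(2 * pi - \<alpha>) / 2 = pi - \<alpha> / 2" by (simp add: field_simps)
  with False have "half_rot (reverse_angle \<alpha>) = mk2 (cos (pi - \<alpha>/2)) (- sin (pi - \<alpha>/2)) (sin (pi - \<alpha>/2)) (cos (pi - \<alpha>/2))"
    by (simp only: reverse_angle_def half_rot_def if_False)
  also have "\<dots> = - rconj (half_rot \<alpha>)"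
    by (simp add: half_rot_def rconj_mk2 mk2_simps)
  finally show ?thesis ..
qed

text \<open>Equality up to sign makes the sine of the difference of the half angles vanish, and that
  difference lies strictly between -pi and pi.\<close>

lemma half_rot_inj:
  assumes "\<alpha> \<in> {0..<2*pi}" "\<beta> \<in> {0..<2*pi}" "half_rot \<beta> = half_rot \<alpha> \<or> half_rot \<beta> = - half_rot \<alpha>"
  shows "\<beta> = \<alpha>"
proof -
  have "sin (\<beta>/2) * cos (\<alpha>/2) = cos (\<beta>/2) * sin (\<alpha>/2)"
    using assms(3) by (auto simp: half_rot_def mk2_simps)
  then have sin: "sin (\<beta>/2 - \<alpha>/2) = 0" by (simp add: sin_diff)
  have "- pi < \<beta>/2 - \<alpha>/2" "\<beta>/2 - \<alpha>/2 < pi" using assms(1,2) by auto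
  then have "\<beta>/2 - \<alpha>/2 = 0" using sin by (rule sin_eq_0_pi)
  then show ?thesis by simp
qed

text \<open>A rotation angle t in [pi, 2 pi) is replaced by t - pi, which only negates the matrix;
  the doubled angle then lies in the required interval.\<close>

lemma half_rot_surj:
  assumes "S \<in> carrier SO2"
  obtains \<alpha> where "\<alpha> \<in> {0..<2*pi}" "PSO2_class (half_rot \<alpha>) = PSO2_class S"
proof -
  obtain c s where cs: "c\<^sup>2 + s\<^sup>2 = 1" "S = rot c s" using assms unfolding SO2_iff by blast
  obtain t where t: "0 \<le> t" "t < 2 * pi" "c = cos t" "s = sin t" using sincos_total_2pi[OF cs(1)] by blast
  show thesis
  proof (cases "t < pi")
    case True
    have "half_rot (2 * t) = S" by (simp add: half_rot_def cs t)
    then show thesis using that[of "2 * t"] t True by simp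
  next
    case False
    have "half_rot (2 * (t - pi)) = mk2 (cos (t - pi)) (- sin (t - pi)) (sin (t - pi)) (cos (t - pi))"
      using nonzero_mult_div_cancel_left[of 2 "t - pi"] unfolding half_rot_def by (simp only: zero_neq_numeral[symmetric] simp_thms)
    also have "\<dots> = - S" by (simp add: cs t mk2_simps)
    finally have "half_rot (2 * (t - pi)) = - S" .
    then show thesis using that[of "2 * (t - pi)"] t False by (simp add: PSO2_class_eq_iff)
  qed
qed

lemma half_rot_class_eq_iff:
  assumes "(\<alpha>1, \<alpha>2) \<in> angles" "(\<beta>1, \<beta>2) \<in> angles"
  shows "PSO2_rel `` {(PSO2_class (half_rot \<alpha>1), PSO2_class (half_rot \<alpha>2))} =
      PSO2_rel `` {(PSO2_class (half_rot \<beta>1), PSO2_class (half_rot \<beta>2))} \<longleftrightarrow>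
    angle_rel `` {(\<alpha>1, \<alpha>2)} = angle_rel `` {(\<beta>1, \<beta>2)}"
proof -
  have 1: "half_rot \<beta> = half_rot \<alpha> \<or> half_rot \<beta> = - half_rot \<alpha> \<longleftrightarrow> \<beta> = \<alpha>"
    and 2: "half_rot \<beta> = rconj (half_rot \<alpha>) \<or> half_rot \<beta> = - rconj (half_rot \<alpha>) \<longleftrightarrow> \<beta> = reverse_angle \<alpha>"
    if "\<alpha> \<in> {0..<2*pi}" "\<beta> \<in> {0..<2*pi}" for \<alpha> \<beta>
  proof -
    show "half_rot \<beta> = half_rot \<alpha> \<or> half_rot \<beta> = - half_rot \<alpha> \<longleftrightarrow> \<beta> = \<alpha>"
      using half_rot_inj[OF that] by blast
    have "half_rot \<beta> = half_rot (reverse_angle \<alpha>) \<or> half_rot \<beta> = - half_rot (reverse_angle \<alpha>) \<longleftrightarrow>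
        \<beta> = reverse_angle \<alpha>"
      using half_rot_inj[OF reverse_angle_in[OF that(1)] that(2)] by blast
    then show "half_rot \<beta> = rconj (half_rot \<alpha>) \<or> half_rot \<beta> = - rconj (half_rot \<alpha>) \<longleftrightarrow> \<beta> = reverse_angle \<alpha>"
      using half_rot_reverse[of \<alpha>]
    proof (elim disjE)
      assume "half_rot (reverse_angle \<alpha>) = - rconj (half_rot \<alpha>)"
        and "half_rot \<beta> = half_rot (reverse_angle \<alpha>) \<or> half_rot \<beta> = - half_rot (reverse_angle \<alpha>) \<longleftrightarrow>
          \<beta> = reverse_angle \<alpha>"
      then show ?thesis by (simp only: minus_minus) blast
    qed (simp only:)
  qed
  have "\<alpha>1 \<in> {0..<2*pi}" "\<alpha>2 \<in> {0..<2*pi}" "\<beta>1 \<in> {0..<2*pi}" "\<beta>2 \<in> {0..<2*pi}"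
    using assms by (auto simp: angles_def)
  then show ?thesis
    unfolding eq_equiv_class_iff[OF equiv_angle_rel assms] angle_rel_iff
      PSO2_rel_class_eq_iff[OF half_rot_in_SO2 half_rot_in_SO2 half_rot_in_SO2 half_rot_in_SO2]
    using 1 2 assms(1) by simp
qed

lemma quotient_PSO2_rel_angles:
  "(carrier PSO2 \<times> carrier PSO2) // PSO2_rel =
    (\<lambda>(\<alpha>1, \<alpha>2). PSO2_rel `` {(PSO2_class (half_rot \<alpha>1), PSO2_class (half_rot \<alpha>2))}) ` angles"
  (is "_ = ?h ` angles")
proof (intro equalityI subsetI)
  fix x assume "x \<in> (carrier PSO2 \<times> carrier PSO2) // PSO2_rel"
  then obtain S1 S2 where S: "S1 \<in> carrier SO2" "S2 \<in> carrier SO2"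
    and x: "x = PSO2_rel `` {(PSO2_class S1, PSO2_class S2)}"
    unfolding quotient_PSO2_rel by (elim imageE SigmaE) (simp only: prod.case)
  obtain \<alpha>1 where \<alpha>1: "\<alpha>1 \<in> {0..<2*pi}" "PSO2_class (half_rot \<alpha>1) = PSO2_class S1" using half_rot_surj[OF S(1)] .
  obtain \<alpha>2 where \<alpha>2: "\<alpha>2 \<in> {0..<2*pi}" "PSO2_class (half_rot \<alpha>2) = PSO2_class S2" using half_rot_surj[OF S(2)] .
  show "x \<in> ?h ` angles"
  proof (rule image_eqI)
    show "x = ?h (\<alpha>1, \<alpha>2)" by (simp only: x \<alpha>1 \<alpha>2 prod.case)
    show "(\<alpha>1, \<alpha>2) \<in> angles" using \<alpha>1 \<alpha>2 by (simp add: angles_def)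
  qed
next
  fix x assume "x \<in> ?h ` angles"
  then obtain \<alpha>1 \<alpha>2 where x: "x = ?h (\<alpha>1, \<alpha>2)" by blast
  show "x \<in> (carrier PSO2 \<times> carrier PSO2) // PSO2_rel"
    unfolding quotient_PSO2_rel
  proof (rule image_eqI)
    show "x = (\<lambda>(S1, S2). PSO2_rel `` {(PSO2_class S1, PSO2_class S2)}) (half_rot \<alpha>1, half_rot \<alpha>2)"
      by (simp only: x prod.case)
    show "(half_rot \<alpha>1, half_rot \<alpha>2) \<in> carrier SO2 \<times> carrier SO2"
      by (simp add: half_rot_in_SO2)
  qed
qed

section \<open>The parametrization\<close>

text \<open>If \<open>f\<close> and \<open>p\<close> have the same fibres on \<open>T\<close>, then
  \<open>f\<close> factors through \<open>p\<close>. One direction of the hypothesis is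
  well-definedness (independence of the \<open>SOME\<close> representative), the other is
  injectivity.\<close>

lemma factor_bijection:
  assumes "\<And>t t'. t \<in> T \<Longrightarrow> t' \<in> T \<Longrightarrow> f t = f t' \<longleftrightarrow> p t = p t'"
  shows "\<exists>F. bij_betw F (p ` T) (f ` T) \<and> (\<forall>t\<in>T. F (p t) = f t)"
proof -
  define F where "F y = f (SOME t. t \<in> T \<and> p t = y)" for y
  have F: "F (p t) = f t" if "t \<in> T" for t
  proof -
    let ?t = "SOME t'. t' \<in> T \<and> p t' = p t"
    have "?t \<in> T \<and> p ?t = p t"
      using someI[of "\<lambda>t'. t' \<in> T \<and> p t' = p t" t] that by simp
    then show ?thesis unfolding F_def using assms[of ?t t] that by simp
  qed
  have "bij_betw F (p ` T) (f ` T)"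
  proof (rule bij_betw_imageI)
    show "inj_on F (p ` T)"
    proof (rule inj_onI)
      fix x y assume "x \<in> p ` T" "y \<in> p ` T" and eq: "F x = F y"
      then obtain t t' where "t \<in> T" "x = p t" "t' \<in> T" "y = p t'" by blast
      with eq show "x = y" using assms[of t t'] F by simp
    qed
    show "F ` p ` T = f ` T" using F by (simp add: image_image cong: image_cong)
  qed
  with F show ?thesis by blast
qed

lemma image_last_component:
  "(\<lambda>(b, c, d, x). (b, c, d, h x)) ` (A \<times> B \<times> C \<times> X) = A \<times> B \<times> C \<times> (h ` X)"
  by force

lemma hexagon_parametrization:
  "\<exists>F. bij_betw F
      (chamber \<times> chamber \<times> chamber \<times> ((carrier PSO2 \<times> carrier PSO2) // PSO2_rel))
      (orbits PSp4 Hgen PSp4_act) \<and>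
    (\<forall>b\<in>chamber. \<forall>c\<in>chamber. \<forall>d\<in>chamber. \<forall>S1\<in>carrier SO2. \<forall>S2\<in>carrier SO2.
      F (b, c, d, PSO2_rel `` {(PSO2_class S1, PSO2_class S2)}) =
        orbit PSp4 PSp4_act (normal_hexagon b c d S1 S2))"
proof -
  define T where "T = chamber \<times> chamber \<times> chamber \<times> (carrier SO2 \<times> carrier SO2)"
  define p :: "_ \<Rightarrow> (real \<times> real) \<times> (real \<times> real) \<times> (real \<times> real) \<times> (mat2 set \<times> mat2 set) set"
    where "p = (\<lambda>(b, c, d, S). (b, c, d, (case S of (S1, S2) \<Rightarrow> PSO2_rel `` {(PSO2_class S1, PSO2_class S2)})))"
  define f where "f = (\<lambda>(b, c, d, S1, S2). orbit PSp4 PSp4_act (normal_hexagon b c d S1 S2))"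
  \<comment> \<open>Lying in one orbit and having equal classes were both computed as the same
    explicit relation between the parameters.\<close>
  have "f t = f t' \<longleftrightarrow> p t = p t'" if T: "t \<in> T" "t' \<in> T" for t t'
  proof -
    obtain b c d S1 S2 where t: "t = (b, c, d, S1, S2)" by (cases t)
    obtain b' c' d' S1' S2' where t': "t' = (b', c', d', S1', S2')" by (cases t')
    have m: "b \<in> chamber" "c \<in> chamber" "d \<in> chamber" "b' \<in> chamber" "c' \<in> chamber" "d' \<in> chamber"
      "S1 \<in> carrier SO2" "S2 \<in> carrier SO2" "S1' \<in> carrier SO2" "S2' \<in> carrier SO2"
      using T by (auto simp: T_def t t')
    have "f t = f t' \<longleftrightarrow> (\<exists>g\<in>carrier Sp4. normal_hexagon b' c' d' S1' S2' = map ((`) ((*v) g)) (normal_hexagon b c d S1 S2))"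
      unfolding t t' f_def prod.case unfolding normal_hexagon_def by (rule orbit_hexagon_eq_iff)
    also have "\<dots> \<longleftrightarrow> p t = p t'"
      unfolding normal_hexagon_same_orbit_iff[OF m] t t' p_def prod.case prod.inject
        PSO2_rel_class_eq_iff[OF m(7-10)] ..
    finally show ?thesis .
  qed
  then obtain F where F: "bij_betw F (p ` T) (f ` T)" "\<And>t. t \<in> T \<Longrightarrow> F (p t) = f t"
    using factor_bijection[of T f p] by blast
  have pT: "p ` T = chamber \<times> chamber \<times> chamber \<times> ((carrier PSO2 \<times> carrier PSO2) // PSO2_rel)"
    unfolding quotient_PSO2_rel T_def p_def by (rule image_last_component)
  \<comment> \<open>One inclusion is genericity of normal hexagons, the other the existence of a
    normal form.\<close>
  have fT: "f ` T = orbits PSp4 Hgen PSp4_act"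
  proof (intro equalityI subsetI)
    fix x assume "x \<in> f ` T"
    then obtain b c d S1 S2 where m: "b \<in> chamber" "c \<in> chamber" "d \<in> chamber" "S1 \<in> carrier SO2" "S2 \<in> carrier SO2"
      and x: "x = orbit PSp4 PSp4_act (normal_hexagon b c d S1 S2)"
      by (auto simp: T_def f_def)
    have "map ((`) ((*v) (mat 1))) (normal_hexagon b c d S1 S2) = normal_hexagon b c d S1 S2"
      by (simp add: map_idI)
    then have "normal_hexagon b c d S1 S2 \<in> Hgen"
      using image_normal_hexagon_in_Hgen[OF one_in_Sp4 m(4,5) m(1-3)] by simp
    then show "x \<in> orbits PSp4 Hgen PSp4_act" unfolding orbits_def x by blast
  next
    fix x assume "x \<in> orbits PSp4 Hgen PSp4_act"
    then obtain y where y: "y \<in> Hgen" "x = orbit PSp4 PSp4_act y" unfolding orbits_def by blast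
    obtain g b c d S1 S2 where g: "g \<in> carrier Sp4" and m: "b \<in> chamber" "c \<in> chamber" "d \<in> chamber"
      "S1 \<in> carrier SO2" "S2 \<in> carrier SO2" and yg: "y = map ((`) ((*v) g)) (normal_hexagon b c d S1 S2)"
      using Hgen_normal_form[OF y(1)] .
    have "x = f (b, c, d, S1, S2)"
      using orbit_image_hexagon[OF g] unfolding y(2) yg f_def normal_hexagon_def by simp
    then show "x \<in> f ` T" using m unfolding T_def by blast
  qed
  show ?thesis
  proof (intro exI conjI ballI)
    show "bij_betw F (chamber \<times> chamber \<times> chamber \<times> ((carrier PSO2 \<times> carrier PSO2) // PSO2_rel))
      (orbits PSp4 Hgen PSp4_act)"
      using F(1) unfolding pT fT .
  next
    fix b c d S1 S2
    assume "b \<in> chamber" "c \<in> chamber" "d \<in> chamber" "S1 \<in> carrier SO2" "S2 \<in> carrier SO2"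
    then have "(b, c, d, S1, S2) \<in> T" by (simp add: T_def)
    from F(2)[OF this] show "F (b, c, d, PSO2_rel `` {(PSO2_class S1, PSO2_class S2)}) =
        orbit PSp4 PSp4_act (normal_hexagon b c d S1 S2)"
      by (simp add: p_def f_def)
  qed
qed

text \<open>Only the last factor changes: \<open>half_rot_class_eq_iff\<close> compares the fibres
  and \<open>quotient_PSO2_rel_angles\<close> gives surjectivity.\<close>

lemma angle_parametrization:
  "\<exists>G. bij_betw G
      (chamber \<times> chamber \<times> chamber \<times> (angles // angle_rel))
      (chamber \<times> chamber \<times> chamber \<times> ((carrier PSO2 \<times> carrier PSO2) // PSO2_rel)) \<and>
    (\<forall>b\<in>chamber. \<forall>c\<in>chamber. \<forall>d\<in>chamber. \<forall>(\<alpha>1, \<alpha>2)\<in>angles.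
      G (b, c, d, angle_rel `` {(\<alpha>1, \<alpha>2)}) =
        (b, c, d, PSO2_rel `` {(PSO2_class (half_rot \<alpha>1), PSO2_class (half_rot \<alpha>2))}))"
proof -
  define h where "h = (\<lambda>(\<alpha>1, \<alpha>2). PSO2_rel `` {(PSO2_class (half_rot \<alpha>1), PSO2_class (half_rot \<alpha>2))})"
  define T where "T = (chamber \<times> chamber \<times> chamber \<times> angles :: ((real \<times> real) \<times> (real \<times> real) \<times> (real \<times> real) \<times> (real \<times> real)) set)"
  define p where "p = (\<lambda>(b :: real \<times> real, c :: real \<times> real, d :: real \<times> real, a). (b, c, d, angle_rel `` {a}))"
  define f where "f = (\<lambda>(b :: real \<times> real, c :: real \<times> real, d :: real \<times> real, a). (b, c, d, h a))"
  have h: "h a = h a' \<longleftrightarrow> angle_rel `` {a} = angle_rel `` {a'}" if "a \<in> angles" "a' \<in> angles" for a a'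
    using that half_rot_class_eq_iff unfolding h_def by (cases a; cases a') simp
  have "f t = f t' \<longleftrightarrow> p t = p t'" if T: "t \<in> T" "t' \<in> T" for t t'
  proof -
    obtain b c d a where t: "t = (b, c, d, a)" by (rule prod_cases4)
    obtain b' c' d' a' where t': "t' = (b', c', d', a')" by (rule prod_cases4)
    have "a \<in> angles" "a' \<in> angles" using T by (auto simp: T_def t t')
    then show ?thesis unfolding t t' f_def p_def prod.case prod.inject using h by blast
  qed
  then obtain G where G: "bij_betw G (p ` T) (f ` T)" "\<And>t. t \<in> T \<Longrightarrow> G (p t) = f t"
    using factor_bijection[of T f p] by blast
  have pT: "p ` T = chamber \<times> chamber \<times> chamber \<times> (angles // angle_rel)"
    unfolding T_def p_def image_last_component by (auto simp: quotient_def)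
  have fT: "f ` T = chamber \<times> chamber \<times> chamber \<times> ((carrier PSO2 \<times> carrier PSO2) // PSO2_rel)"
    unfolding T_def f_def quotient_PSO2_rel_angles h_def[symmetric] by (rule image_last_component)
  show ?thesis
  proof (intro exI conjI ballI)
    show "bij_betw G (chamber \<times> chamber \<times> chamber \<times> (angles // angle_rel))
      (chamber \<times> chamber \<times> chamber \<times> ((carrier PSO2 \<times> carrier PSO2) // PSO2_rel))"
      using G(1) unfolding pT fT .
  next
    fix b c d a
    assume "b \<in> chamber" "c \<in> chamber" "d \<in> chamber" "a \<in> angles"
    then have "(b, c, d, a) \<in> T" by (simp add: T_def)
    from G(2)[OF this] show "case a of (\<alpha>1, \<alpha>2) \<Rightarrow> G (b, c, d, angle_rel `` {(\<alpha>1, \<alpha>2)}) =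
        (b, c, d, PSO2_rel `` {(PSO2_class (half_rot \<alpha>1), PSO2_class (half_rot \<alpha>2))})"
      by (cases a) (simp add: p_def f_def h_def)
  qed
qed

theorem proposition4p15:
  shows
    "equiv (carrier PSO2 \<times> carrier PSO2) PSO2_rel \<and>
     (\<exists>F :: (real \<times> real) \<times> (real \<times> real) \<times> (real \<times> real) \<times> (mat2 set \<times> mat2 set) set
             \<Rightarrow> subsp4 list set.
        bij_betw F
          (chamber \<times> chamber \<times> chamber \<times> ((carrier PSO2 \<times> carrier PSO2) // PSO2_rel))
          (orbits PSp4 Hgen PSp4_act) \<and>
        (\<forall>b\<in>chamber. \<forall>c\<in>chamber. \<forall>d\<in>chamber. \<forall>S1\<in>carrier SO2. \<forall>S2\<in>carrier SO2.
           F (b, c, d, PSO2_rel `` {(PSO2_class S1, PSO2_class S2)}) =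
             orbit PSp4 PSp4_act
               [Lag 0, Lag (parA b S1), Lag (mat 1), Lag (parC c), Lag (parD c d S2), Lag_inf])) \<and>
     equiv angles angle_rel \<and>
     (\<exists>G :: (real \<times> real) \<times> (real \<times> real) \<times> (real \<times> real) \<times> (real \<times> real) set
             \<Rightarrow> (real \<times> real) \<times> (real \<times> real) \<times> (real \<times> real) \<times> (mat2 set \<times> mat2 set) set.
        bij_betw G
          (chamber \<times> chamber \<times> chamber \<times> (angles // angle_rel))
          (chamber \<times> chamber \<times> chamber \<times> ((carrier PSO2 \<times> carrier PSO2) // PSO2_rel)) \<and>
        (\<forall>b\<in>chamber. \<forall>c\<in>chamber. \<forall>d\<in>chamber. \<forall>(\<alpha>1, \<alpha>2)\<in>angles.
           G (b, c, d, angle_rel `` {(\<alpha>1, \<alpha>2)}) =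
             (b, c, d, PSO2_rel `` {(PSO2_class (half_rot \<alpha>1), PSO2_class (half_rot \<alpha>2))})))"
  using equiv_PSO2_rel hexagon_parametrization equiv_angle_rel angle_parametrization
  unfolding normal_hexagon_def hexagon_def by (simp only: list.map append.simps)

end
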